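(* Let $G$ be a locally convex Lie group and let $B$ be a closed subgroup of $G$ for which there exists a subset $N\subseteq G$ such that the following conditions are satisfied: (1) $\mathbf{1}\in N$; (2) $N$ is homeomorphic to an open set in some locally convex space, and that homeomorphism makes $N$ into a manifold such that the inclusion $N\hookrightarrow G$ is a smooth mapping; (3) there exists an open neighborhood $\Omega$ of $\mathbf{1}\in G$ such that the multiplication mapping $N\times B\to\Omega$, $(n,b)\mapsto nb$, is a homeomorphism and the corresponding projection mapping $\sigma\colon\Omega\to N$, $nb\mapsto n$, is smooth. Then the homogeneous space $G/B$ endowed with the quotient topology has a structure of manifold (with the same model space as $N$) such that the natural projection $\pi\colon G\to G/B$ is smooth and open, and the natural action $G\times G/B\to G/B$, $(g,xB)\mapsto gxB$, is smooth. Moreover, if $N'\subseteq G$ is another subset satisfying (1)--(3), then it defines on $G/B$ the same smooth structure as $N$.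
   Context: Smoothness of maps between open subsets of locally convex spaces is in the sense of Michal-Bastiani calculus ($C^\infty$: all iterated directional derivatives exist and are jointly continuous); manifolds and Lie groups modeled on (Hausdorff) locally convex spaces are defined accordingly. The statement is understood to apply equally with "smooth" read as $C^\infty$ throughout, or as real analytic throughout. The subset $N\subseteq G$ carries the subspace topology. The smooth structure on $G/B$ defined by a subset $N$ satisfying (1)--(3) is the one for which, for every $g\in G$, the injective map $\psi_g\colon N\to G/B$, $n\mapsto gnB$, is a diffeomorphism of $N$ onto an open subset of $G/B$ (i.e. the inverses of the maps $\psi_g$, $g\in G$, form an atlas). *)

theory Defs
  imports "HOL-Analysis.Analysis" "HOL-Algebra.Left_Coset"
begin

section \<open>Locally convex spaces\<close>

class locally_convex_space = real_vector + topological_ab_group_add + t2_space +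
  assumes tendsto_scaleR_Pair:
      "LIM p (nhds (t::real) \<times>\<^sub>F nhds x). fst p *\<^sub>R snd p :> nhds (t *\<^sub>R x)"
    and convex_nhds_base_unfolded:
      "open U \<Longrightarrow> 0 \<in> U \<Longrightarrow> \<exists>V. open V \<and> 0 \<in> V \<and> V \<subseteq> U \<and>
         (\<forall>x\<in>V. \<forall>y\<in>V. \<forall>u\<ge>0. \<forall>v\<ge>0. u + v = (1::real) \<longrightarrow> u *\<^sub>R x + v *\<^sub>R y \<in> V)"

lemma tendsto_scaleR_lcs:
  fixes x :: "'a::locally_convex_space"
  assumes "(f \<longlongrightarrow> t) F" "(g \<longlongrightarrow> x) F"
  shows "((\<lambda>z. f z *\<^sub>R g z) \<longlongrightarrow> t *\<^sub>R x) F"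
  using filterlim_compose[OF tendsto_scaleR_Pair, of "\<lambda>z. (f z, g z)" t x F] assms
  by (simp add: nhds_prod[symmetric] tendsto_Pair)

lemma convex_nhds_base:
  fixes U :: "'a::locally_convex_space set"
  assumes "open U" "0 \<in> U"
  shows "\<exists>V. open V \<and> convex V \<and> 0 \<in> V \<and> V \<subseteq> U"
  using convex_nhds_base_unfolded[OF assms] unfolding convex_def by blast

instance prod :: (topological_monoid_add, topological_monoid_add) topological_monoid_add
proof
  fix a b :: "'a \<times> 'b"
  have "((\<lambda>x. (fst (fst x) + fst (snd x), snd (fst x) + snd (snd x)))
          \<longlongrightarrow> (fst a + fst b, snd a + snd b)) (nhds (a, b))"
  proof -
    have "((\<lambda>x. fst x) \<longlongrightarrow> a) (nhds (a, b))" "((\<lambda>x. snd x) \<longlongrightarrow> b) (nhds (a, b))"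
      using tendsto_fst[OF filterlim_ident, of "(a, b)"] tendsto_snd[OF filterlim_ident, of "(a, b)"]
      by simp_all
    then show ?thesis
      by (intro tendsto_Pair tendsto_add tendsto_fst tendsto_snd)
  qed
  then show "((\<lambda>x. fst x + snd x) \<longlongrightarrow> a + b) (nhds a \<times>\<^sub>F nhds b)"
    by (simp add: nhds_prod[symmetric] plus_prod_def)
qed

instance prod :: (topological_group_add, topological_group_add) topological_group_add
proof
  fix a :: "'a \<times> 'b"
  have "((\<lambda>x. (- fst x, - snd x)) \<longlongrightarrow> (- fst a, - snd a)) (nhds a)"
    by (intro tendsto_Pair tendsto_minus tendsto_fst tendsto_snd filterlim_ident)
  then show "(uminus \<longlongrightarrow> - a) (nhds a)"
    unfolding uminus_prod_def[abs_def] .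
qed

instance prod :: (topological_ab_group_add, topological_ab_group_add) topological_ab_group_add ..

instance prod :: (locally_convex_space, locally_convex_space) locally_convex_space
proof
  fix t :: real and x :: "'a \<times> 'b"
  have "((\<lambda>p. (fst p *\<^sub>R fst (snd p), fst p *\<^sub>R snd (snd p)))
          \<longlongrightarrow> (t *\<^sub>R fst x, t *\<^sub>R snd x)) (nhds (t, x))"
  proof -
    have "((\<lambda>p. fst p) \<longlongrightarrow> t) (nhds (t, x))" "((\<lambda>p. snd p) \<longlongrightarrow> x) (nhds (t, x))"
      using tendsto_fst[OF filterlim_ident, of "(t, x)"] tendsto_snd[OF filterlim_ident, of "(t, x)"]
      by simp_all
    then show ?thesis
      by (intro tendsto_Pair tendsto_scaleR_lcs tendsto_fst tendsto_snd)
  qed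
  then show "((\<lambda>p. fst p *\<^sub>R snd p) \<longlongrightarrow> t *\<^sub>R x) (nhds t \<times>\<^sub>F nhds x)"
    by (simp add: nhds_prod[symmetric] scaleR_prod_def)
next
  fix U :: "('a \<times> 'b) set"
  assume "open U" "0 \<in> U"
  then have "(0, 0) \<in> U" by (simp add: zero_prod_def)
  with \<open>open U\<close> obtain S T
    where ST: "open S" "open T" "(0::'a) \<in> S" "(0::'b) \<in> T" "S \<times> T \<subseteq> U"
    by (elim open_prod_elim) auto
  obtain V where "open V" "convex V" "0 \<in> V" "V \<subseteq> S"
    using convex_nhds_base ST by blast
  moreover obtain W where "open W" "convex W" "0 \<in> W" "W \<subseteq> T"
    using convex_nhds_base ST by blast
  ultimately have "open (V \<times> W) \<and> convex (V \<times> W) \<and> 0 \<in> V \<times> W \<and> V \<times> W \<subseteq> U"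
    using ST(5) by (auto simp: zero_prod_def intro: open_Times convex_Times)
  then show "\<exists>V. open V \<and> 0 \<in> V \<and> V \<subseteq> U \<and>
      (\<forall>x\<in>V. \<forall>y\<in>V. \<forall>u\<ge>0. \<forall>v\<ge>0. u + v = (1::real) \<longrightarrow> u *\<^sub>R x + v *\<^sub>R y \<in> V)"
    unfolding convex_def by (intro exI[of _ "V \<times> W"]) simp
qed


section \<open>Smooth and real analytic maps\<close>

definition diff_quotient ::
  "('e::locally_convex_space \<Rightarrow> 'f::locally_convex_space) \<Rightarrow> 'e \<Rightarrow> 'e \<Rightarrow> real \<Rightarrow> 'f"
  where "diff_quotient f x v t = (f (x + t *\<^sub>R v) - f x) /\<^sub>R t"

definition dir_deriv ::
  "('e::locally_convex_space \<Rightarrow> 'f::locally_convex_space) \<Rightarrow> 'e \<Rightarrow> 'e \<Rightarrow> 'f"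
  where "dir_deriv f x v = Lim (at 0) (diff_quotient f x v)"

text \<open>
  \<open>iter_deriv k f v x\<close> is the iterated directional derivative
  \<open>D\<^bsub>v (k-1)\<^esub> \<dots> D\<^bsub>v 0\<^esub> f (x)\<close>.  A tuple of \<open>k\<close> directions is encoded by a
  sequence of which only the first \<open>k\<close> entries matter, so that joint continuity in
  \<open>(x, v)\<close> for the product topology on \<open>nat \<Rightarrow> 'e\<close> is joint continuity on \<open>U \<times> E\<^sup>k\<close>.
\<close>

primrec iter_deriv ::
  "nat \<Rightarrow> ('e::locally_convex_space \<Rightarrow> 'f::locally_convex_space) \<Rightarrow> (nat \<Rightarrow> 'e) \<Rightarrow> 'e \<Rightarrow> 'f"
  where
    "iter_deriv 0 f v x = f x"
  | "iter_deriv (Suc k) f v x = dir_deriv (iter_deriv k f v) x (v k)"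

definition C_infinity_on ::
  "'e set \<Rightarrow> ('e::locally_convex_space \<Rightarrow> 'f::locally_convex_space) \<Rightarrow> bool"
  where "C_infinity_on U f \<longleftrightarrow> open U \<and>
    (\<forall>k. continuous_on (U \<times> UNIV) (\<lambda>(x, v). iter_deriv k f v x) \<and>
         (\<forall>x\<in>U. \<forall>v. \<exists>l. (diff_quotient (iter_deriv k f v) x (v k) \<longlongrightarrow> l) (at 0)))"

text \<open>The complexification of \<open>E\<close> is \<open>E \<times> E\<close>, where \<open>(x, y)\<close> stands for \<open>x + \<i> y\<close>.\<close>

definition mult_i :: "'e \<times> 'e \<Rightarrow> 'e \<times> 'e::locally_convex_space"
  where "mult_i z = (- snd z, fst z)"

definition holomorphic_smooth_on ::
  "('e \<times> 'e) set \<Rightarrow> ('e::locally_convex_space \<times> 'e \<Rightarrow> 'f::locally_convex_space \<times> 'f) \<Rightarrow> bool"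
  where "holomorphic_smooth_on W h \<longleftrightarrow> C_infinity_on W h \<and>
    (\<forall>z\<in>W. \<forall>v. dir_deriv h z (mult_i v) = mult_i (dir_deriv h z v))"

text \<open>
  Real analytic maps are those that locally extend to complex analytic maps between the
  complexifications; complex analytic maps are the smooth maps with complex linear differential.
\<close>

definition C_omega_on ::
  "'e set \<Rightarrow> ('e::locally_convex_space \<Rightarrow> 'f::locally_convex_space) \<Rightarrow> bool"
  where "C_omega_on U f \<longleftrightarrow> open U \<and>
    (\<forall>x\<in>U. \<exists>W h. (x, 0) \<in> W \<and> holomorphic_smooth_on W h \<and>
       (\<forall>y\<in>U. (y, 0) \<in> W \<longrightarrow> h (y, 0) = (f y, 0)))"

datatype smoothness_class = C_infinity | C_omega

fun smooth_on ::
  "smoothness_class \<Rightarrow> 'e set \<Rightarrow> ('e::locally_convex_space \<Rightarrow> 'f::locally_convex_space) \<Rightarrow> bool"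
  where
    "smooth_on C_infinity = C_infinity_on"
  | "smooth_on C_omega = C_omega_on"


section \<open>Manifolds modeled on locally convex spaces\<close>

type_synonym ('a, 'e) chart = "'a set \<times> ('a \<Rightarrow> 'e)"

definition is_chart :: "'a topology \<Rightarrow> ('a, 'e::locally_convex_space) chart \<Rightarrow> bool"
  where "is_chart X = (\<lambda>(U, \<phi>). openin X U \<and> open (\<phi> ` U) \<and>
    homeomorphic_map (subtopology X U) (top_of_set (\<phi> ` U)) \<phi>)"

definition smooth_transition ::
  "smoothness_class \<Rightarrow> ('a, 'e::locally_convex_space) chart \<Rightarrow> ('a, 'e) chart \<Rightarrow> bool"
  where "smooth_transition r = (\<lambda>(U, \<phi>) (V, \<psi>). smooth_on r (\<phi> ` (U \<inter> V)) (\<psi> \<circ> inv_into U \<phi>))"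

definition manifold ::
  "smoothness_class \<Rightarrow> 'a topology \<Rightarrow> ('a, 'e::locally_convex_space) chart set \<Rightarrow> bool"
  where "manifold r X A \<longleftrightarrow> Hausdorff_space X \<and>
    (\<forall>c\<in>A. is_chart X c) \<and> (\<Union>c\<in>A. fst c) = topspace X \<and>
    (\<forall>c\<in>A. \<forall>d\<in>A. smooth_transition r c d)"

definition smooth_map ::
  "smoothness_class \<Rightarrow>
   'a topology \<Rightarrow> ('a, 'e::locally_convex_space) chart set \<Rightarrow>
   'b topology \<Rightarrow> ('b, 'f::locally_convex_space) chart set \<Rightarrow> ('a \<Rightarrow> 'b) \<Rightarrow> bool"
  where "smooth_map r X A Y B f \<longleftrightarrow> continuous_map X Y f \<and>
    (\<forall>(U, \<phi>)\<in>A. \<forall>(V, \<psi>)\<in>B. smooth_on r (\<phi> ` {x\<in>U. f x \<in> V}) (\<psi> \<circ> f \<circ> inv_into U \<phi>))"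

definition diffeomorphism ::
  "smoothness_class \<Rightarrow>
   'a topology \<Rightarrow> ('a, 'e::locally_convex_space) chart set \<Rightarrow>
   'b topology \<Rightarrow> ('b, 'f::locally_convex_space) chart set \<Rightarrow> ('a \<Rightarrow> 'b) \<Rightarrow> bool"
  where "diffeomorphism r X A Y B f \<longleftrightarrow>
    (\<exists>g. homeomorphic_maps X Y f g \<and> smooth_map r X A Y B f \<and> smooth_map r Y B X A g)"

text \<open>Two atlases may be modeled on different types and still define the same structure.\<close>

definition same_smooth_structure ::
  "smoothness_class \<Rightarrow> 'a topology \<Rightarrow>
   ('a, 'e::locally_convex_space) chart set \<Rightarrow> ('a, 'f::locally_convex_space) chart set \<Rightarrow> bool"
  where "same_smooth_structure r X A A' \<longleftrightarrow> diffeomorphism r X A X A' (\<lambda>x. x)"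

definition prod_atlas ::
  "('a, 'e) chart set \<Rightarrow> ('b, 'f) chart set \<Rightarrow> ('a \<times> 'b, 'e \<times> 'f) chart set"
  where "prod_atlas A B = (\<lambda>((U, \<phi>), (V, \<psi>)). (U \<times> V, map_prod \<phi> \<psi>)) ` (A \<times> B)"

definition restrict_atlas :: "('a, 'e) chart set \<Rightarrow> 'a set \<Rightarrow> ('a, 'e) chart set"
  where "restrict_atlas A W = (\<lambda>(U, \<phi>). (U \<inter> W, \<phi>)) ` A"


section \<open>Lie groups and homogeneous spaces\<close>

definition lie_group ::
  "smoothness_class \<Rightarrow> ('a, 'b) monoid_scheme \<Rightarrow> 'a topology \<Rightarrow>
   ('a, 'e::locally_convex_space) chart set \<Rightarrow> bool"
  where "lie_group r G X A \<longleftrightarrow> group G \<and> topspace X = carrier G \<and> manifold r X A \<and>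
    smooth_map r (prod_topology X X) (prod_atlas A A) X A (\<lambda>(x, y). x \<otimes>\<^bsub>G\<^esub> y) \<and>
    smooth_map r X A X A (\<lambda>x. inv\<^bsub>G\<^esub> x)"

definition quotient_topology :: "'a topology \<Rightarrow> ('a \<Rightarrow> 'b) \<Rightarrow> 'b topology"
  where "quotient_topology X f =
    topology (\<lambda>U. U \<subseteq> f ` topspace X \<and> openin X {x \<in> topspace X. f x \<in> U})"

lemma openin_quotient_topology:
  "openin (quotient_topology X f) U \<longleftrightarrow> U \<subseteq> f ` topspace X \<and> openin X {x \<in> topspace X. f x \<in> U}"
proof -
  have "istopology (\<lambda>U. U \<subseteq> f ` topspace X \<and> openin X {x \<in> topspace X. f x \<in> U})"
    unfolding istopology_def
  proof (intro conjI allI impI)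
    fix S T assume S: "S \<subseteq> f ` topspace X \<and> openin X {x \<in> topspace X. f x \<in> S}"
      and T: "T \<subseteq> f ` topspace X \<and> openin X {x \<in> topspace X. f x \<in> T}"
    show "S \<inter> T \<subseteq> f ` topspace X" using S by blast
    have "{x \<in> topspace X. f x \<in> S \<inter> T} =
        {x \<in> topspace X. f x \<in> S} \<inter> {x \<in> topspace X. f x \<in> T}" by blast
    then show "openin X {x \<in> topspace X. f x \<in> S \<inter> T}" using S T by auto
  next
    fix K assume K: "\<forall>S\<in>K. S \<subseteq> f ` topspace X \<and> openin X {x \<in> topspace X. f x \<in> S}"
    show "\<Union>K \<subseteq> f ` topspace X" using K by blast
    have "{x \<in> topspace X. f x \<in> \<Union>K} = (\<Union>S\<in>K. {x \<in> topspace X. f x \<in> S})" by blast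
    then show "openin X {x \<in> topspace X. f x \<in> \<Union>K}" using K by auto
  qed
  then show ?thesis
    by (simp add: quotient_topology_def)
qed

lemma topspace_quotient_topology: "topspace (quotient_topology X f) = f ` topspace X"
proof
  show "topspace (quotient_topology X f) \<subseteq> f ` topspace X"
    using openin_quotient_topology[of X f "topspace (quotient_topology X f)"] by simp
  have "{x \<in> topspace X. f x \<in> f ` topspace X} = topspace X" by blast
  then show "f ` topspace X \<subseteq> topspace (quotient_topology X f)"
    by (intro openin_subset) (simp add: openin_quotient_topology)
qed

lemma quotient_map_quotient_topology: "quotient_map X (quotient_topology X f) f"
  by (auto simp: quotient_map_def openin_quotient_topology topspace_quotient_topology)

definition coset_topology :: "('a, 'b) monoid_scheme \<Rightarrow> 'a topology \<Rightarrow> 'a set \<Rightarrow> 'a set topology"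
  where "coset_topology G X B = quotient_topology X (\<lambda>x. x <#\<^bsub>G\<^esub> B)"

lemma topspace_coset_topology:
  "topspace X = carrier G \<Longrightarrow> topspace (coset_topology G X B) = lcosets\<^bsub>G\<^esub> B"
  by (auto simp: coset_topology_def topspace_quotient_topology LCOSETS_def)

text \<open>
  The homeomorphism \<open>\<eta>\<close> of \<open>N\<close> onto an open set is the global chart that makes \<open>N\<close>, with the
  subspace topology, a manifold.  The projection \<open>\<sigma>\<close> is determined on \<open>\<Omega> = NB\<close>.
\<close>

definition coset_slice ::
  "smoothness_class \<Rightarrow> ('a, 'b) monoid_scheme \<Rightarrow> 'a topology \<Rightarrow>
   ('a, 'e::locally_convex_space) chart set \<Rightarrow> 'a set \<Rightarrow>
   'a set \<Rightarrow> ('a \<Rightarrow> 'f::locally_convex_space) \<Rightarrow> bool"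
  where "coset_slice r G X A B N \<eta> \<longleftrightarrow>
    N \<subseteq> carrier G \<and>
    \<one>\<^bsub>G\<^esub> \<in> N \<and>
    manifold r (subtopology X N) {(N, \<eta>)} \<and>
    smooth_map r (subtopology X N) {(N, \<eta>)} X A (\<lambda>n. n) \<and>
    (\<exists>\<Omega> \<sigma>. openin X \<Omega> \<and> \<one>\<^bsub>G\<^esub> \<in> \<Omega> \<and>
       homeomorphic_map (prod_topology (subtopology X N) (subtopology X B)) (subtopology X \<Omega>)
         (\<lambda>(n, b). n \<otimes>\<^bsub>G\<^esub> b) \<and>
       (\<forall>n\<in>N. \<forall>b\<in>B. \<sigma> (n \<otimes>\<^bsub>G\<^esub> b) = n) \<and>
       smooth_map r (subtopology X \<Omega>) (restrict_atlas A \<Omega>) (subtopology X N) {(N, \<eta>)} \<sigma>)"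

definition coset_param :: "('a, 'b) monoid_scheme \<Rightarrow> 'a set \<Rightarrow> 'a \<Rightarrow> 'a \<Rightarrow> 'a set"
  where "coset_param G B g n = (g \<otimes>\<^bsub>G\<^esub> n) <#\<^bsub>G\<^esub> B"

text \<open>The atlas of \<open>G/B\<close> that consists of the inverses of the maps \<open>\<psi>\<^sub>g : N \<rightarrow> G/B\<close>, \<open>n \<mapsto> gnB\<close>.\<close>

definition coset_atlas ::
  "('a, 'b) monoid_scheme \<Rightarrow> 'a set \<Rightarrow> 'a set \<Rightarrow> ('a \<Rightarrow> 'f) \<Rightarrow> ('a set, 'f) chart set"
  where "coset_atlas G B N \<eta> =
    (\<lambda>g. (coset_param G B g ` N, \<eta> \<circ> inv_into N (coset_param G B g))) ` carrier G"

end

theory Submission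
  imports Defs
begin

text \<open>
  The conditions on \<open>N\<close> say that \<open>x B \<mapsto> \<sigma> (g\<^sup>-\<^sup>1 x)\<close> inverts \<open>\<psi>\<^sub>g\<close> on the image of \<open>g \<Omega>\<close>.
  Since \<open>\<sigma>\<close> and left translations are smooth, this makes \<open>\<pi> : G \<rightarrow> G/B\<close> smooth for the atlas of the
  inverses of the \<open>\<psi>\<^sub>g\<close>.  A map out of \<open>G/B\<close> is smooth when its composites with all \<open>\<psi>\<^sub>g\<close> are, and
  \<open>\<psi>\<^sub>g = \<pi> \<circ> L\<^sub>g \<circ> (N \<hookrightarrow> G)\<close> is smooth as soon as \<open>\<pi>\<close> is, for whichever atlas of this kind.  So the
  transition maps, the action and the comparison with \<open>N'\<close> all reduce to the smoothness of \<open>\<pi>\<close>.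

  The analytic input is the chain rule of Michal--Bastiani calculus, which rests on a mean value
  theorem for convex sets.  For real analytic maps it is applied to the holomorphic extensions.
\<close>

section \<open>Mean value theorem and strict differentiability\<close>

text \<open>The model spaces carry no norm and need not be complete, so neither operator estimates
  nor integrals are at hand; this is why the mean value theorem speaks of increments lying in a
  convex open set. Moreover, \<open>C_infinity_on\<close> only posits that directional derivatives
  exist and are jointly continuous. Linearity in the directions is a consequence of strict
  differentiability and has to be established before the chain rule. On the manifold side,
  smoothness is tested in all pairs of charts, and composition asks only that charts be injective
  and cover, so product and restricted atlases never have to be shown to be manifolds. The topology
  of \<open>G/B\<close> rests on the openness of the projection, which comes from right translations
  by \<open>B\<close>; the Hausdorff property and the continuity of the action are drawn from
  it.\<close>

lemma tendsto_fun:
  fixes f :: "'i \<Rightarrow> 'a \<Rightarrow> 'b::topological_space"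
  assumes "\<And>j. ((\<lambda>i. f i j) \<longlongrightarrow> l j) F"
  shows "(f \<longlongrightarrow> l) F"
proof -
  have "limitin (product_topology (\<lambda>_. euclidean) UNIV) f l F"
    using assms by (simp add: limitin_componentwise del: euclidean_product_topology)
  then show ?thesis by (simp add: euclidean_product_topology)
qed

text \<open>Division by \<open>a + b\<close> turns the sum into a convex combination; if
  \<open>a + b = 0\<close>, both weights vanish and any point of \<open>C\<close> serves.\<close>

lemma convex_scaleR_add:
  fixes C :: "'a::real_vector set"
  assumes "convex C" "x \<in> C" "y \<in> C" "0 \<le> a" "0 \<le> b"
  obtains z where "z \<in> C" "a *\<^sub>R x + b *\<^sub>R y = (a + b) *\<^sub>R z"
proof (cases "a + b = 0")
  case True
  then show ?thesis using assms that[of x] by (simp add: add_nonneg_eq_0_iff)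
next
  case False
  have "(a / (a + b)) *\<^sub>R x + (b / (a + b)) *\<^sub>R y \<in> C"
    using assms False by (intro convexD) (auto simp: add_divide_distrib[symmetric])
  then show ?thesis using False by (intro that) (auto simp: scaleR_add_right)
qed

text \<open>
  A mean value theorem without functionals: by convexity the property "the increment over
  \<open>[p, q]\<close> is \<open>q - p\<close> times an element of \<open>C\<close>" is additive in intervals, and it holds on small
  intervals around each point because \<open>C\<close> is open.
\<close>

lemma increment_in_convex:
  fixes c :: "real \<Rightarrow> 'a::locally_convex_space"
  assumes ab: "a \<le> b" and C: "convex C" "open C"
    and lim: "\<And>s. a \<le> s \<Longrightarrow> s \<le> b \<Longrightarrow> ((\<lambda>t. (c t - c s) /\<^sub>R (t - s)) \<longlongrightarrow> c' s) (at s)"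
    and mem: "\<And>s. a \<le> s \<Longrightarrow> s \<le> b \<Longrightarrow> c' s \<in> C"
  shows "\<exists>z\<in>C. c b - c a = (b - a) *\<^sub>R z"
proof -
  have join: "\<exists>z\<in>C. c r - c p = (r - p) *\<^sub>R z"
    if z: "\<exists>z\<in>C. c q - c p = (q - p) *\<^sub>R z" "\<exists>z\<in>C. c r - c q = (r - q) *\<^sub>R z"
      and pq: "p \<le> q" "q \<le> r" for p q r
  proof -
    obtain z z' where z: "z \<in> C" "c q - c p = (q - p) *\<^sub>R z" "z' \<in> C" "c r - c q = (r - q) *\<^sub>R z'"
      using z by blast
    obtain w where w: "w \<in> C" "(q - p) *\<^sub>R z + (r - q) *\<^sub>R z' = ((q - p) + (r - q)) *\<^sub>R w"
      using convex_scaleR_add[OF C(1) z(1,3), of "q - p" "r - q"] pq by auto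
    have "c r - c p = (c q - c p) + (c r - c q)" by simp
    also have "\<dots> = (r - p) *\<^sub>R w" unfolding z using w by simp
    finally show ?thesis using w(1) by blast
  qed
  have "a \<le> a \<longrightarrow> b \<le> b \<longrightarrow> (\<exists>z\<in>C. c b - c a = (b - a) *\<^sub>R z)"
    using ab
  proof (induction rule: Bolzano)
    case (trans p q r)
    then show ?case using join[of q p r] by auto
  next
    case (local x)
    have "\<forall>\<^sub>F t in at x. (c t - c x) /\<^sub>R (t - x) \<in> C"
      using topological_tendstoD[OF lim C(2) mem] local by auto
    then obtain d where d: "d > 0" "\<And>t. t \<noteq> x \<Longrightarrow> dist t x < d \<Longrightarrow> (c t - c x) /\<^sub>R (t - x) \<in> C"
      by (auto simp: eventually_at)
    have near: "\<exists>z\<in>C. c t - c x = (t - x) *\<^sub>R z" if "dist t x < d" for t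
    proof (cases "t = x")
      case True
      then show ?thesis using mem[of x] local by auto
    next
      case False
      then show ?thesis using d(2)[OF False that] by (intro bexI[of _ "(c t - c x) /\<^sub>R (t - x)"]) auto
    qed
    show ?case
    proof (intro exI[of _ d] conjI allI impI d(1))
      fix p q assume pq: "p \<le> x \<and> x \<le> q \<and> q - p < d"
      obtain z where z: "z \<in> C" "c p - c x = (p - x) *\<^sub>R z"
        using near[of p] pq by (auto simp: dist_real_def)
      have "c x - c p = (x - p) *\<^sub>R z"
        using arg_cong[OF z(2), of uminus] by (simp add: algebra_simps)
      then show "\<exists>z\<in>C. c q - c p = (q - p) *\<^sub>R z"
        using join[of x p q] near[of q] pq z(1) by (auto simp: dist_real_def)
    qed
  qed
  then show ?thesis by simp
qed

lemma locally_convex_nhds: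
  fixes l :: "'a::locally_convex_space"
  assumes "open S" "l \<in> S"
  obtains C where "open C" "convex C" "l \<in> C" "C \<subseteq> S"
proof -
  have "open ((\<lambda>x. l + x) -` S)"
    by (rule open_vimage[OF assms(1)]) (intro continuous_intros)
  then obtain V where V: "open V" "convex V" "0 \<in> V" "V \<subseteq> (\<lambda>x. l + x) -` S"
    using convex_nhds_base assms(2) by (metis add.right_neutral vimageI)
  have *: "(\<lambda>x. l + x) ` V = (\<lambda>x. x - l) -` V"
  proof (intro equalityI subsetI)
    fix x assume "x \<in> (\<lambda>x. x - l) -` V"
    then show "x \<in> (\<lambda>x. l + x) ` V"
      by (intro image_eqI[of _ _ "x - l"]) auto
  qed auto
  show ?thesis
  proof
    show "open ((\<lambda>x. l + x) ` V)" unfolding * 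
      by (rule open_vimage[OF V(1)]) (intro continuous_intros)
    show "convex ((\<lambda>x. l + x) ` V)" using V(2) by (rule convex_translation)
  qed (use V in auto)
qed

text \<open>Reads a directional derivative at \<open>x + s *\<^sub>R v\<close> as the derivative at
  \<open>s\<close> of the curve \<open>t \<mapsto> f (x + t *\<^sub>R v)\<close>, which is the form
  that \<open>increment_in_convex\<close> takes.\<close>

lemma tendsto_diff_quotient_shift:
  assumes "(diff_quotient f (x + s *\<^sub>R v) v \<longlongrightarrow> l) (at 0)"
  shows "((\<lambda>t. (f (x + t *\<^sub>R v) - f (x + s *\<^sub>R v)) /\<^sub>R (t - s)) \<longlongrightarrow> l) (at s)"
proof -
  have "at s = filtermap (\<lambda>t. t + s) (at 0)"
    using filtermap_at_shift[of "-s" 0] by simp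
  then show ?thesis
    using assms by (simp add: filterlim_filtermap diff_quotient_def[abs_def] algebra_simps)
qed

text \<open>Strict differentiability, with the function, the base point and the direction all varying.\<close>

lemma diff_quotient_strict:
  fixes H :: "'i \<Rightarrow> 'e::locally_convex_space \<Rightarrow> 'f::locally_convex_space"
  assumes conv: "((\<lambda>(i, s). H' i s) \<longlongrightarrow> l) (F \<times>\<^sub>F nhds 0)"
    and deriv: "\<forall>\<^sub>F (i, s) in F \<times>\<^sub>F nhds 0.
      (diff_quotient (H i) (y i + s *\<^sub>R w i) (w i) \<longlongrightarrow> H' i s) (at 0)"
    and t: "(t \<longlongrightarrow> 0) F" and t0: "\<forall>\<^sub>F i in F. t i \<noteq> 0"
  shows "((\<lambda>i. diff_quotient (H i) (y i) (w i) (t i)) \<longlongrightarrow> l) F"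
proof (rule topological_tendstoI)
  fix S assume "open S" "l \<in> S"
  then obtain C where C: "open C" "convex C" "l \<in> C" "C \<subseteq> S"
    by (rule locally_convex_nhds)
  have "\<forall>\<^sub>F p in F \<times>\<^sub>F nhds 0. H' (fst p) (snd p) \<in> C \<and>
      (diff_quotient (H (fst p)) (y (fst p) + snd p *\<^sub>R w (fst p)) (w (fst p)) \<longlongrightarrow> H' (fst p) (snd p)) (at 0)"
    using topological_tendstoD[OF conv C(1,3)] deriv by eventually_elim auto
  \<comment> \<open>The product filter separates the condition on \<open>i\<close> from the one on
    \<open>s\<close>. This gives one interval around 0 that is good for all \<open>i\<close> with
    \<open>P i\<close> at once, so that the mean value theorem applies to each curve up to time
    \<open>t i\<close>.\<close>
  then obtain P Q where PQ: "eventually P F" "eventually Q (nhds (0::real))"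
    and good: "\<And>i s. P i \<Longrightarrow> Q s \<Longrightarrow> H' i s \<in> C \<and>
      (diff_quotient (H i) (y i + s *\<^sub>R w i) (w i) \<longlongrightarrow> H' i s) (at 0)"
    unfolding eventually_prod_filter by auto
  obtain d where d: "d > 0" "\<And>s. \<bar>s\<bar> < d \<Longrightarrow> Q s"
    using PQ(2) unfolding eventually_nhds_metric by (auto simp: dist_real_def)
  have "\<forall>\<^sub>F i in F. \<bar>t i\<bar> < d"
    using tendstoD[OF t d(1)] by (simp add: dist_real_def)
  with PQ(1) t0 show "\<forall>\<^sub>F i in F. diff_quotient (H i) (y i) (w i) (t i) \<in> S"
  proof eventually_elim
    case (elim i)
    define c where "c s = H i (y i + s *\<^sub>R w i)" for s
    have *: "\<exists>z\<in>C. c q - c p = (q - p) *\<^sub>R z" if "p \<le> q" "\<bar>p\<bar> < d" "\<bar>q\<bar> < d" for p q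
    proof (rule increment_in_convex[OF that(1) C(2,1)])
      fix s assume "p \<le> s" "s \<le> q"
      then have "H' i s \<in> C \<and> (diff_quotient (H i) (y i + s *\<^sub>R w i) (w i) \<longlongrightarrow> H' i s) (at 0)"
        using that by (intro good elim d(2)) auto
      then show "H' i s \<in> C" "((\<lambda>t. (c t - c s) /\<^sub>R (t - s)) \<longlongrightarrow> H' i s) (at s)"
        unfolding c_def by (auto intro: tendsto_diff_quotient_shift)
    qed
    have "\<exists>z\<in>C. c (t i) - c 0 = t i *\<^sub>R z"
    \<comment> \<open>The mean value theorem is stated for oriented intervals; for negative
      \<open>t i\<close> it is applied from \<open>t i\<close> to 0 and both sides are
      negated.\<close>
    proof (cases "t i \<ge> 0")
      case True
      then show ?thesis using *[of 0 "t i"] elim d by simp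
    next
      case False
      then obtain z where z: "z \<in> C" "c 0 - c (t i) = - t i *\<^sub>R z"
        using *[of "t i" 0] elim d by auto
      then have "c (t i) - c 0 = t i *\<^sub>R z"
        using arg_cong[OF z(2), of uminus] by (simp add: algebra_simps)
      then show ?thesis using z(1) by blast
    qed
    then show ?case
      using elim C(4) by (auto simp: diff_quotient_def c_def)
  qed
qed

section \<open>Iterated directional derivatives\<close>

lemma tendsto_fun_coordinate:
  fixes f :: "'i \<Rightarrow> 'a \<Rightarrow> 'b::topological_space"
  assumes "(f \<longlongrightarrow> l) F"
  shows "((\<lambda>i. f i j) \<longlongrightarrow> l j) F"
proof -
  have "limitin (product_topology (\<lambda>_. euclidean) UNIV) f l F"
    using assms by (simp add: euclidean_product_topology)
  then show ?thesis by (simp add: limitin_componentwise del: euclidean_product_topology)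
qed

lemma diff_quotient_cong:
  assumes "open U" "x \<in> U" and eq: "\<And>y. y \<in> U \<Longrightarrow> f y = g y"
  shows "\<forall>\<^sub>F t in at 0. diff_quotient f x v t = diff_quotient g x v t"
proof -
  have "((\<lambda>t. x + t *\<^sub>R v) \<longlongrightarrow> x + 0 *\<^sub>R v) (at 0)"
    by (intro tendsto_intros tendsto_scaleR_lcs)
  then have "\<forall>\<^sub>F t in at 0. x + t *\<^sub>R v \<in> U"
    using assms by (auto dest!: topological_tendstoD)
  then show ?thesis
    by eventually_elim (simp add: diff_quotient_def eq assms)
qed

lemma dir_deriv_eqI: "(diff_quotient f x v \<longlongrightarrow> l) (at 0) \<Longrightarrow> dir_deriv f x v = l"
  unfolding dir_deriv_def by (rule tendsto_Lim) simp_all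

text \<open>Only the first \<open>k\<close> entries are read. Hence entry \<open>k\<close> may be
  overwritten by the next direction without changing the derivative of order \<open>k\<close>, a
  device used throughout.\<close>

lemma iter_deriv_cong:
  assumes "\<And>j. j < k \<Longrightarrow> u j = v j"
  shows "iter_deriv k f u = iter_deriv k f v"
  using assms
proof (induction k)
  case (Suc k)
  then have "iter_deriv k f u = iter_deriv k f v" "u k = v k" by auto
  then show ?case by (intro ext) simp
qed (simp add: fun_eq_iff)

text \<open>The definition of smoothness grants some limit; as the target is Hausdorff, it is the
  one that \<open>Lim\<close> selects in \<open>dir_deriv\<close>.\<close>

lemma C_infinity_on_deriv:
  assumes "C_infinity_on U f" "x \<in> U"
  shows "(diff_quotient (iter_deriv k f v) x (v k) \<longlongrightarrow> iter_deriv (Suc k) f v x) (at 0)"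
  using assms dir_deriv_eqI unfolding C_infinity_on_def by fastforce

lemma C_infinity_on_tendsto:
  assumes f: "C_infinity_on U f" and x: "x0 \<in> U" "(x \<longlongrightarrow> x0) F" and v: "(v \<longlongrightarrow> v0) F"
  shows "((\<lambda>i. iter_deriv k f (v i) (x i)) \<longlongrightarrow> iter_deriv k f v0 x0) F"
proof -
  have U: "open U" and cont: "continuous_on (U \<times> UNIV) (\<lambda>(x, v). iter_deriv k f v x)"
    using f by (auto simp: C_infinity_on_def)
  have "\<forall>\<^sub>F i in F. (x i, v i) \<in> U \<times> UNIV"
    using topological_tendstoD[OF x(2) U x(1)] by simp
  then have "((\<lambda>i. (\<lambda>(x, v). iter_deriv k f v x) (x i, v i))
      \<longlongrightarrow> (\<lambda>(x, v). iter_deriv k f v x) (x0, v0)) F"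
    using x(1) by (intro continuous_on_tendsto_compose[OF cont tendsto_Pair[OF x(2) v]]) auto
  then show ?thesis by simp
qed

text \<open>Here \<open>H'\<close> of \<open>diff_quotient_strict\<close> is the derivative of the
  next order, and joint continuity supplies its convergence. Base point, earlier directions and new
  direction may all move; linearity and the chain rule both need this freedom.\<close>

lemma C_infinity_on_strict:
  fixes u :: "'i \<Rightarrow> nat \<Rightarrow> 'e::locally_convex_space"
  assumes f: "C_infinity_on U f" and y: "y0 \<in> U" "(y \<longlongrightarrow> y0) F"
    and u: "(u \<longlongrightarrow> u0) F" and w: "(w \<longlongrightarrow> w0) F"
    and t: "(t \<longlongrightarrow> 0) F" "\<forall>\<^sub>F i in F. t i \<noteq> 0"
  shows "((\<lambda>i. diff_quotient (iter_deriv m f (u i)) (y i) (w i) (t i))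
          \<longlongrightarrow> iter_deriv (Suc m) f (u0(m := w0)) y0) F"
proof (rule diff_quotient_strict[OF _ _ t])
  let ?G = "F \<times>\<^sub>F nhds (0::real)"
  have fst: "filterlim fst F ?G" and snd: "filterlim snd (nhds 0) ?G"
    by (rule filterlim_fst filterlim_snd)+
  have "((\<lambda>p. y (fst p) + snd p *\<^sub>R w (fst p)) \<longlongrightarrow> y0 + 0 *\<^sub>R w0) ?G"
    by (intro tendsto_add tendsto_scaleR_lcs snd filterlim_compose[OF y(2) fst]
        filterlim_compose[OF w fst])
  then have z: "((\<lambda>p. y (fst p) + snd p *\<^sub>R w (fst p)) \<longlongrightarrow> y0) ?G" by simp
  have uw: "((\<lambda>i. (u i)(m := w i)) \<longlongrightarrow> u0(m := w0)) F"
  proof (rule tendsto_fun)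
    fix j
    have "((\<lambda>i. u i j) \<longlongrightarrow> u0 j) F"
      using u by (rule tendsto_fun_coordinate)
    then show "((\<lambda>i. ((u i)(m := w i)) j) \<longlongrightarrow> (u0(m := w0)) j) F"
      using w by auto
  qed
  show "((\<lambda>(i, s). iter_deriv (Suc m) f ((u i)(m := w i)) (y i + s *\<^sub>R w i))
      \<longlongrightarrow> iter_deriv (Suc m) f (u0(m := w0)) y0) ?G"
    using C_infinity_on_tendsto[OF f y(1) z filterlim_compose[OF uw fst], of "Suc m"]
    by (simp only: case_prod_unfold)
  have "\<forall>\<^sub>F p in ?G. y (fst p) + snd p *\<^sub>R w (fst p) \<in> U"
    using topological_tendstoD[OF z] f y(1) by (simp add: C_infinity_on_def)
  then show "\<forall>\<^sub>F (i, s) in ?G. (diff_quotient (iter_deriv m f (u i)) (y i + s *\<^sub>R w i) (w i)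
      \<longlongrightarrow> iter_deriv (Suc m) f ((u i)(m := w i)) (y i + s *\<^sub>R w i)) (at 0)"
  proof eventually_elim
    case (elim p)
    have "iter_deriv m f ((u (fst p))(m := w (fst p))) = iter_deriv m f (u (fst p))"
      by (rule iter_deriv_cong) simp
    then show ?case
      using C_infinity_on_deriv[OF f elim, of m "(u (fst p))(m := w (fst p))"]
      by (simp add: case_prod_beta del: iter_deriv.simps)
  qed
qed

text \<open>In the last direction, the increment along \<open>a + s *\<^sub>R b\<close> is split at
  \<open>y + t *\<^sub>R a\<close> into one along \<open>a\<close> from \<open>y\<close> and one
  along \<open>b\<close> from the moving point, the latter with step \<open>s * t\<close>; strict
  differentiability gives its limit. In an earlier direction the identity passes from order
  \<open>m\<close> to the difference quotients, hence to the derivative of order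
  \<open>Suc m\<close>.\<close>

lemma iter_deriv_linear:
  assumes f: "C_infinity_on U f" and "y \<in> U" "j < m"
  shows "iter_deriv m f (u(j := a + s *\<^sub>R b)) y =
    iter_deriv m f (u(j := a)) y + s *\<^sub>R iter_deriv m f (u(j := b)) y"
  using assms(2,3)
proof (induction m arbitrary: y)
  case (Suc m)
  have U: "open U" using f by (simp add: C_infinity_on_def)
  note deriv = C_infinity_on_deriv[OF f Suc.prems(1)]
  show ?case
  proof (cases "j = m")
    case False
    then have j: "j < m" using Suc.prems by simp
    let ?g = "\<lambda>c. iter_deriv m f (u(j := c))"
    have "((\<lambda>t. diff_quotient (?g a) y (u m) t + s *\<^sub>R diff_quotient (?g b) y (u m) t)
        \<longlongrightarrow> iter_deriv (Suc m) f (u(j := a)) y + s *\<^sub>R iter_deriv (Suc m) f (u(j := b)) y) (at 0)"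
      using deriv[of m "u(j := a)"] deriv[of m "u(j := b)"] False
      by (intro tendsto_add tendsto_scaleR_lcs tendsto_const) (simp_all del: iter_deriv.simps)
    moreover have "\<forall>\<^sub>F t in at 0. diff_quotient (?g (a + s *\<^sub>R b)) y (u m) t =
        diff_quotient (\<lambda>z. ?g a z + s *\<^sub>R ?g b z) y (u m) t"
      by (rule diff_quotient_cong[OF U Suc.prems(1)]) (rule Suc.IH[OF _ j])
    then have "\<forall>\<^sub>F t in at 0. diff_quotient (?g a) y (u m) t + s *\<^sub>R diff_quotient (?g b) y (u m) t =
        diff_quotient (?g (a + s *\<^sub>R b)) y (u m) t"
      by eventually_elim (simp add: diff_quotient_def algebra_simps)
    ultimately have "(diff_quotient (?g (a + s *\<^sub>R b)) y (u m)
        \<longlongrightarrow> iter_deriv (Suc m) f (u(j := a)) y + s *\<^sub>R iter_deriv (Suc m) f (u(j := b)) y) (at 0)"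
      by (rule Lim_transform_eventually)
    moreover have "iter_deriv (Suc m) f (u(j := c)) y = dir_deriv (?g c) y (u m)" for c
    proof -
      have "(u(j := c)) m = u m" using False by simp
      then show ?thesis by (simp only: iter_deriv.simps)
    qed
    ultimately show ?thesis by (metis dir_deriv_eqI)
  next
    case True
    have upd: "iter_deriv m f (u(m := c)) = iter_deriv m f u" for c
      by (rule iter_deriv_cong) simp
    let ?g = "iter_deriv m f u"
    have lim: "(diff_quotient ?g y c \<longlongrightarrow> iter_deriv (Suc m) f (u(m := c)) y) (at 0)" for c
      using deriv[of m "u(m := c)"] upd by (simp del: iter_deriv.simps)
    show ?thesis
    \<comment> \<open>Strict differentiability is applied with step \<open>s * t\<close>, which must
      not vanish, so \<open>s = 0\<close> is handled apart.\<close>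
    proof (cases "s = 0")
      case False
      have st: "((\<lambda>t. s * t) \<longlongrightarrow> 0) (at 0)"
        by (intro tendsto_eq_intros) auto
      have "((\<lambda>t. y + t *\<^sub>R a) \<longlongrightarrow> y + 0 *\<^sub>R a) (at 0)"
        by (intro tendsto_intros tendsto_scaleR_lcs)
      then have "((\<lambda>t. diff_quotient ?g (y + t *\<^sub>R a) b (s * t))
          \<longlongrightarrow> iter_deriv (Suc m) f (u(m := b)) y) (at 0)"
        using False
        by (intro C_infinity_on_strict[OF f Suc.prems(1)] tendsto_const st)
          (auto simp: eventually_at_filter)
      then have "((\<lambda>t. diff_quotient ?g y a t + s *\<^sub>R diff_quotient ?g (y + t *\<^sub>R a) b (s * t))
          \<longlongrightarrow> iter_deriv (Suc m) f (u(m := a)) y + s *\<^sub>R iter_deriv (Suc m) f (u(m := b)) y) (at 0)"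
        by (intro tendsto_add tendsto_scaleR_lcs lim tendsto_const)
      moreover have "diff_quotient ?g y a t + s *\<^sub>R diff_quotient ?g (y + t *\<^sub>R a) b (s * t) =
          diff_quotient ?g y (a + s *\<^sub>R b) t" for t
        using False
        by (simp add: diff_quotient_def algebra_simps) (simp add: mult.assoc[symmetric])
      ultimately have "(diff_quotient ?g y (a + s *\<^sub>R b)
          \<longlongrightarrow> iter_deriv (Suc m) f (u(m := a)) y + s *\<^sub>R iter_deriv (Suc m) f (u(m := b)) y) (at 0)"
        by simp
      then show ?thesis
        unfolding True by (rule tendsto_unique[OF at_neq_bot lim])
    qed (simp add: True)
  qed
qed simp

text \<open>
  The iterated derivatives need not be computed: it suffices that \<open>f\<close> belongs to some class \<open>P\<close> of
  continuous functions of \<open>x\<close> and a sequence \<open>v\<close> of directions that is stable under derivatives.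
\<close>

lemma C_infinity_onI:
  fixes f :: "'e::locally_convex_space \<Rightarrow> 'f::locally_convex_space"
    and P :: "((nat \<Rightarrow> 'e) \<Rightarrow> 'e \<Rightarrow> 'f) \<Rightarrow> bool"
  assumes U: "open U" and f: "P (\<lambda>v. f)"
    and cont: "\<And>p. P p \<Longrightarrow> continuous_on (U \<times> UNIV) (\<lambda>(x, v). p v x)"
    and step: "\<And>p n. P p \<Longrightarrow>
      \<exists>q. P q \<and> (\<forall>v. \<forall>x\<in>U. (diff_quotient (p v) x (v n) \<longlongrightarrow> q v x) (at 0))"
  shows "C_infinity_on U f"
proof -
  have transfer: "(diff_quotient (iter_deriv k f v) x (v k) \<longlongrightarrow> l) (at 0)"
    if eq: "\<forall>v. \<forall>x\<in>U. iter_deriv k f v x = p v x" and x: "x \<in> U"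
      and lim: "(diff_quotient (p v) x (v k) \<longlongrightarrow> l) (at 0)" for k p v x l
  proof (rule Lim_transform_eventually[OF lim])
    show "\<forall>\<^sub>F t in at 0. diff_quotient (p v) x (v k) t = diff_quotient (iter_deriv k f v) x (v k) t"
      by (rule diff_quotient_cong[OF U x]) (simp add: eq)
  qed
  \<comment> \<open>Agreement with a member of \<open>P\<close> is claimed on \<open>U\<close> only;
    as \<open>U\<close> is open, this suffices to pass to difference quotients at points of
    \<open>U\<close>.\<close>
  have ex: "\<exists>p. P p \<and> (\<forall>v. \<forall>x\<in>U. iter_deriv k f v x = p v x)" for k
  proof (induction k)
    case 0
    then show ?case using f by (intro exI[of _ "\<lambda>v. f"]) simp
  next
    case (Suc k)
    then obtain p where p: "P p" "\<forall>v. \<forall>x\<in>U. iter_deriv k f v x = p v x" by blast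
    obtain q where q: "P q" "\<And>v x. x \<in> U \<Longrightarrow> (diff_quotient (p v) x (v k) \<longlongrightarrow> q v x) (at 0)"
      using step[OF p(1)] by blast
    have "\<forall>v. \<forall>x\<in>U. iter_deriv (Suc k) f v x = q v x"
      using transfer[OF p(2) _ q(2)] by (simp add: dir_deriv_eqI)
    then show ?case using q(1) by blast
  qed
  show ?thesis
    unfolding C_infinity_on_def
  proof (intro conjI allI ballI U)
    fix k
    obtain p where p: "P p" "\<forall>v. \<forall>x\<in>U. iter_deriv k f v x = p v x" using ex by blast
    show "continuous_on (U \<times> UNIV) (\<lambda>(x, v). iter_deriv k f v x)"
      by (rule continuous_on_eq[OF cont[OF p(1)]]) (use p(2) in auto)
    fix x v assume "x \<in> U"
    then show "\<exists>l. (diff_quotient (iter_deriv k f v) x (v k) \<longlongrightarrow> l) (at 0)"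
      using step[OF p(1), of k] transfer[OF p(2)] by blast
  qed
qed


text \<open>In \<open>C_infinity_onI\<close> the next direction is \<open>v n\<close> with
  \<open>n\<close> arbitrary, whereas \<open>iter_deriv\<close> always takes entry \<open>k\<close>
  next. The selector \<open>s\<close> decouples the two: redefining it at \<open>k\<close> as
  \<open>n\<close> makes \<open>v n\<close> the next direction and leaves the derivative of order
  \<open>k\<close> alone.\<close>

lemma C_infinity_on_deriv_select:
  assumes "C_infinity_on U f" "x \<in> U"
  shows "(diff_quotient (iter_deriv k f (v \<circ> s)) x (v n)
    \<longlongrightarrow> iter_deriv (Suc k) f (v \<circ> s(k := n)) x) (at 0)"
proof -
  have "iter_deriv k f (v \<circ> s(k := n)) = iter_deriv k f (v \<circ> s)"
    by (rule iter_deriv_cong) simp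
  then show ?thesis
    using C_infinity_on_deriv[OF assms, of k "v \<circ> s(k := n)"] by (simp del: iter_deriv.simps)
qed

lemma C_infinity_on_continuous_select:
  fixes f :: "'e::locally_convex_space \<Rightarrow> 'f::locally_convex_space"
  assumes "C_infinity_on U f"
  shows "continuous_on (U \<times> UNIV) (\<lambda>(x, v :: nat \<Rightarrow> 'e). iter_deriv k f (v \<circ> s) x)"
  unfolding continuous_on_def case_prod_beta
proof
  fix p :: "'e \<times> (nat \<Rightarrow> 'e)"
  assume p: "p \<in> U \<times> UNIV"
  show "((\<lambda>p. iter_deriv k f (snd p \<circ> s) (fst p)) \<longlongrightarrow> iter_deriv k f (snd p \<circ> s) (fst p))
      (at p within U \<times> UNIV)"
  proof (rule C_infinity_on_tendsto[OF assms])
    show "((\<lambda>p. snd p \<circ> s) \<longlongrightarrow> snd p \<circ> s) (at p within U \<times> UNIV)"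
      unfolding comp_def
      by (intro tendsto_fun tendsto_fun_coordinate[OF tendsto_snd] tendsto_ident_at)
  qed (use p in \<open>auto intro: tendsto_intros\<close>)
qed

section \<open>Permanence properties of smooth maps: local agreement, unions, pairs, affine
  maps\<close>

lemma C_infinity_on_cong:
  fixes f :: "'e::locally_convex_space \<Rightarrow> 'f::locally_convex_space"
  assumes f: "C_infinity_on U f" and eq: "\<And>x. x \<in> U \<Longrightarrow> f x = g x"
  shows "C_infinity_on U g"
\<comment> \<open>The class consists of functions that agree on \<open>U\<close> with a derivative
  of \<open>f\<close> along selected directions; nothing is said off \<open>U\<close>, where
  \<open>g\<close> is arbitrary.\<close>
proof (rule C_infinity_onI[where P = "\<lambda>p. \<exists>k s. \<forall>v. \<forall>x\<in>U. p v x = iter_deriv k f (v \<circ> s) x"])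
  show U: "open U" using f by (simp add: C_infinity_on_def)
  show "\<exists>k s. \<forall>v. \<forall>x\<in>U. g x = iter_deriv k f (v \<circ> s) x"
    by (rule exI[of _ 0]) (simp add: eq)
  fix p :: "(nat \<Rightarrow> 'e) \<Rightarrow> 'e \<Rightarrow> 'f" and n
  assume "\<exists>k s. \<forall>v. \<forall>x\<in>U. p v x = iter_deriv k f (v \<circ> s) x"
  then obtain k s where ks: "\<forall>v. \<forall>x\<in>U. p v x = iter_deriv k f (v \<circ> s) x" by blast
  show "continuous_on (U \<times> UNIV) (\<lambda>(x, v). p v x)"
    by (rule continuous_on_eq[OF C_infinity_on_continuous_select[OF f]]) (use ks in auto)
  show "\<exists>q. (\<exists>k s. \<forall>v. \<forall>x\<in>U. q v x = iter_deriv k f (v \<circ> s) x) \<and>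
      (\<forall>v. \<forall>x\<in>U. (diff_quotient (p v) x (v n) \<longlongrightarrow> q v x) (at 0))"
  proof (intro exI conjI allI ballI)
    fix v x assume x: "x \<in> U"
    show "(diff_quotient (p v) x (v n) \<longlongrightarrow> iter_deriv (Suc k) f (v \<circ> s(k := n)) x) (at 0)"
      by (rule Lim_transform_eventually[OF C_infinity_on_deriv_select[OF f x]
            diff_quotient_cong[OF U x]]) (simp add: ks comp_def)
  qed (rule refl)
qed

lemma C_infinity_on_Union:
  assumes "\<And>V. V \<in> \<V> \<Longrightarrow> C_infinity_on V f"
  shows "C_infinity_on (\<Union>\<V>) f"
proof -
  have *: "\<Union>((\<lambda>V. V \<times> UNIV) ` \<V>) = \<Union>\<V> \<times> UNIV" by auto
  have "continuous_on (\<Union>((\<lambda>V. V \<times> UNIV) ` \<V>)) (\<lambda>(x, v). iter_deriv k f v x)" for k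
    using assms by (intro continuous_on_open_Union) (auto simp: C_infinity_on_def open_Times)
  then have "continuous_on (\<Union>\<V> \<times> UNIV) (\<lambda>(x, v). iter_deriv k f v x)" for k
    unfolding * .
  then show ?thesis
    using assms unfolding C_infinity_on_def by (blast intro: open_Union)
qed

lemma C_infinity_on_subset:
  assumes "C_infinity_on U f" "open V" "V \<subseteq> U"
  shows "C_infinity_on V f"
  using assms unfolding C_infinity_on_def
  by (auto intro: continuous_on_subset[OF _ Sigma_mono])

lemma C_infinity_on_imp_continuous_on:
  assumes "C_infinity_on U f"
  shows "continuous_on U f"
proof -
  have "continuous_on (U \<times> UNIV) (\<lambda>(x, v). iter_deriv 0 f v x)"
    using assms unfolding C_infinity_on_def by blast
  then have "continuous_on U (\<lambda>x. (\<lambda>(x, v). iter_deriv 0 f v x) (x, \<lambda>_. 0))"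
    by (rule continuous_on_compose2) (auto intro: continuous_intros)
  then show ?thesis by simp
qed

lemma C_infinity_on_Pair:
  fixes f :: "'e::locally_convex_space \<Rightarrow> 'f::locally_convex_space"
    and g :: "'e \<Rightarrow> 'g::locally_convex_space"
  assumes f: "C_infinity_on U f" and g: "C_infinity_on U g"
  shows "C_infinity_on U (\<lambda>x. (f x, g x))"
proof (rule C_infinity_onI[where
      P = "\<lambda>p. \<exists>k s. p = (\<lambda>v x. (iter_deriv k f (v \<circ> s) x, iter_deriv k g (v \<circ> s) x))"])
  show "open U" using f by (simp add: C_infinity_on_def)
  show "\<exists>k s. (\<lambda>(v :: nat \<Rightarrow> 'e) x. (f x, g x)) =
      (\<lambda>v x. (iter_deriv k f (v \<circ> s) x, iter_deriv k g (v \<circ> s) x))"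
    by (rule exI[of _ 0]) simp
  fix p :: "(nat \<Rightarrow> 'e) \<Rightarrow> 'e \<Rightarrow> 'f \<times> 'g" and n
  assume "\<exists>k s. p = (\<lambda>v x. (iter_deriv k f (v \<circ> s) x, iter_deriv k g (v \<circ> s) x))"
  then obtain k s where p: "p = (\<lambda>v x. (iter_deriv k f (v \<circ> s) x, iter_deriv k g (v \<circ> s) x))"
    by blast
  show "continuous_on (U \<times> UNIV) (\<lambda>(x, v). p v x)"
    using continuous_on_Pair[OF C_infinity_on_continuous_select[OF f] C_infinity_on_continuous_select[OF g]]
    by (simp add: p case_prod_beta)
  show "\<exists>q. (\<exists>k s. q = (\<lambda>v x. (iter_deriv k f (v \<circ> s) x, iter_deriv k g (v \<circ> s) x))) \<and>
      (\<forall>v. \<forall>x\<in>U. (diff_quotient (p v) x (v n) \<longlongrightarrow> q v x) (at 0))"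
  proof (intro exI conjI allI ballI)
    fix v x assume x: "x \<in> U"
    have "diff_quotient (p v) x (v n) =
        (\<lambda>t. (diff_quotient (iter_deriv k f (v \<circ> s)) x (v n) t,
             diff_quotient (iter_deriv k g (v \<circ> s)) x (v n) t))"
      by (simp add: p diff_quotient_def fun_eq_iff)
    then show "(diff_quotient (p v) x (v n) \<longlongrightarrow> (iter_deriv (Suc k) f (v \<circ> s(k := n)) x,
        iter_deriv (Suc k) g (v \<circ> s(k := n)) x)) (at 0)"
      using tendsto_Pair[OF C_infinity_on_deriv_select[OF f x] C_infinity_on_deriv_select[OF g x]]
      by simp
  qed (rule refl)
qed

lemma diff_quotient_affine:
  fixes L :: "'e::locally_convex_space \<Rightarrow> 'f::locally_convex_space"
  assumes "linear L"
  shows "(diff_quotient (\<lambda>x. L x + c) x v \<longlongrightarrow> L v) (at 0)"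
  by (intro tendsto_eventually)
    (simp add: eventually_at_filter diff_quotient_def linear_add[OF assms] linear_scale[OF assms])

lemma C_infinity_on_affine:
  fixes L :: "'e::locally_convex_space \<Rightarrow> 'f::locally_convex_space"
  assumes "open U" "linear L" and cont: "continuous_on UNIV L"
  shows "C_infinity_on U (\<lambda>x. L x + c)"
\<comment> \<open>The successive derivatives of an affine map: the map itself, its linear part at
  one direction, and zero from then on.\<close>
proof (rule C_infinity_onI[where P = "\<lambda>p. p = (\<lambda>v x. L x + c) \<or> (\<exists>n. p = (\<lambda>v x. L (v n))) \<or> p = (\<lambda>v x. 0)"])
  fix p :: "(nat \<Rightarrow> 'e) \<Rightarrow> 'e \<Rightarrow> 'f" and n
  assume p: "p = (\<lambda>v x. L x + c) \<or> (\<exists>n. p = (\<lambda>v x. L (v n))) \<or> p = (\<lambda>v x. 0)"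
  have coord: "continuous_on A (\<lambda>x. snd x n)" for A :: "('e \<times> (nat \<Rightarrow> 'e)) set" and n
    using continuous_on_compose2[OF continuous_on_product_coordinates continuous_on_snd[OF continuous_on_id]]
    by auto
  show "continuous_on (U \<times> UNIV) (\<lambda>(x, v). p v x)"
    using p by (auto simp: case_prod_beta intro!: continuous_intros coord
        continuous_on_compose2[OF cont])
  note lim = diff_quotient_affine[OF assms(2), of c]
  have const: "diff_quotient (\<lambda>x. c) = (\<lambda>x v t. 0)" for c :: 'f
    by (simp add: fun_eq_iff diff_quotient_def)
  show "\<exists>q. (q = (\<lambda>v x. L x + c) \<or> (\<exists>n. q = (\<lambda>v x. L (v n))) \<or> q = (\<lambda>v x. 0)) \<and>
      (\<forall>v. \<forall>x\<in>U. (diff_quotient (p v) x (v n) \<longlongrightarrow> q v x) (at 0))"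
    using p
  proof
    assume "p = (\<lambda>v x. L x + c)"
    then show ?thesis using lim by (intro exI[of _ "\<lambda>v x. L (v n)"]) auto
  next
    assume "(\<exists>n. p = (\<lambda>v x. L (v n))) \<or> p = (\<lambda>v x. 0)"
    then show ?thesis by (intro exI[of _ "\<lambda>v x. 0"]) (auto simp: const)
  qed
qed (use assms in auto)

section \<open>The chain rule\<close>

lemma C_infinity_on_diff_quotient:
  assumes "C_infinity_on U f" "x \<in> U"
  shows "(diff_quotient f x v \<longlongrightarrow> dir_deriv f x v) (at 0)"
proof -
  have "iter_deriv 0 f (\<lambda>_. v) = f" by (simp add: fun_eq_iff)
  then show ?thesis
    using C_infinity_on_deriv[OF assms, of 0 "\<lambda>_. v"] by simp
qed

lemma add_scaleR_diff_quotient: "t \<noteq> 0 \<Longrightarrow> f x + t *\<^sub>R diff_quotient f x v t = f (x + t *\<^sub>R v)"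
  by (simp add: diff_quotient_def)

text \<open>For \<open>t \<noteq> 0\<close>, \<open>f (x + t *\<^sub>R v)\<close> is
  \<open>f x + t *\<^sub>R w\<close> with \<open>w\<close> the difference quotient of
  \<open>f\<close>; strict differentiability of \<open>g\<close> allows this direction to vary with
  \<open>t\<close>. The formula is what makes complex linearity of differentials pass to
  composites.\<close>

lemma dir_deriv_compose:
  assumes f: "C_infinity_on U f" and g: "C_infinity_on V g" and x: "x \<in> U" "f x \<in> V"
  shows "dir_deriv (g \<circ> f) x v = dir_deriv g (f x) (dir_deriv f x v)"
proof (rule dir_deriv_eqI)
  have [simp]: "iter_deriv 0 g u = g" for u by (simp add: fun_eq_iff)
  have "((\<lambda>t. diff_quotient (iter_deriv 0 g ((\<lambda>_ _. 0) t)) (f x) (diff_quotient f x v t) t)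
      \<longlongrightarrow> iter_deriv (Suc 0) g ((\<lambda>_. 0)(0 := dir_deriv f x v)) (f x)) (at 0)"
    by (intro C_infinity_on_strict[OF g x(2)] tendsto_const tendsto_ident_at
        C_infinity_on_diff_quotient[OF f x(1)]) (simp add: eventually_at_filter)
  then have "((\<lambda>t. diff_quotient g (f x) (diff_quotient f x v t) t)
      \<longlongrightarrow> dir_deriv g (f x) (dir_deriv f x v)) (at 0)"
    by simp
  then show "(diff_quotient (g \<circ> f) x v \<longlongrightarrow> dir_deriv g (f x) (dir_deriv f x v)) (at 0)"
  proof (rule Lim_transform_eventually)
    have "\<forall>\<^sub>F t in at (0::real). t \<noteq> 0" by (simp add: eventually_at_filter)
    then show "\<forall>\<^sub>F t in at 0. diff_quotient g (f x) (diff_quotient f x v t) t = diff_quotient (g \<circ> f) x v t"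
      by eventually_elim
        (simp add: diff_quotient_def[of g] diff_quotient_def[of "g \<circ> f"] add_scaleR_diff_quotient)
  qed
qed

text \<open>
  The sums of terms \<open>D\<^bsup>m\<^esup>g(f(x))(D\<^bsup>\<kappa> 0\<^esup>f(x), D\<^bsup>\<kappa> 1\<^esup>f(x), \<dots>)\<close>, where the directions in each inner
  derivative are selected from the sequence \<open>v\<close>, contain \<open>g \<circ> f\<close> and are stable under directional
  derivatives.  This replaces the formula of Faa di Bruno.
\<close>

inductive composite_term ::
  "('e::locally_convex_space \<Rightarrow> 'f::locally_convex_space) \<Rightarrow> ('f \<Rightarrow> 'g::locally_convex_space) \<Rightarrow>
    ((nat \<Rightarrow> 'e) \<Rightarrow> 'e \<Rightarrow> 'g) \<Rightarrow> bool"
  for f g where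
  zero: "composite_term f g (\<lambda>v x. 0)"
| base: "composite_term f g (\<lambda>v x. iter_deriv m g (\<lambda>j. iter_deriv (\<kappa> j) f (v \<circ> s j) x) (f x))"
| add: "composite_term f g p \<Longrightarrow> composite_term f g q \<Longrightarrow> composite_term f g (\<lambda>v x. p v x + q v x)"

lemma composite_term_sum:
  fixes n :: nat
  assumes "\<And>i. i < n \<Longrightarrow> composite_term f g (p i)"
  shows "composite_term f g (\<lambda>v x. \<Sum>i<n. p i v x)"
  using assms by (induct n) (auto intro: composite_term.intros)

text \<open>Differentiation replaces one inner slot, or fills the new slot \<open>m\<close>.
  Updating \<open>\<kappa>\<close> and \<open>s\<close> at that index brings the result back to the
  shape of \<open>base\<close>.\<close>

lemma composite_term_update:
  "composite_term f g (\<lambda>v x. iter_deriv m g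
      ((\<lambda>j. iter_deriv (\<kappa> j) f (v \<circ> s j) x)(i := iter_deriv k f (v \<circ> a) x)) (f x))"
proof -
  have "(\<lambda>j. iter_deriv (\<kappa> j) f (v \<circ> s j) x)(i := iter_deriv k f (v \<circ> a) x) =
      (\<lambda>j. iter_deriv ((\<kappa>(i := k)) j) f (v \<circ> (s(i := a)) j) x)" for v x
    by auto
  then show ?thesis by (simp only: composite_term.base)
qed

text \<open>A telescoping sum: the directions are changed from \<open>u\<close> to \<open>u0\<close>
  one slot at a time, and linearity in slot \<open>j\<close> evaluates the change made there. At
  that moment the slots below \<open>j\<close> are already old and those above \<open>j\<close>
  still new.\<close>

lemma iter_deriv_increment:
  assumes g: "C_infinity_on V g" and y: "y \<in> V"
    and step: "\<And>j. j < m \<Longrightarrow> u j = u0 j + t *\<^sub>R q j"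
  shows "iter_deriv m g u y - iter_deriv m g u0 y =
    (\<Sum>j<m. t *\<^sub>R iter_deriv m g (\<lambda>i. if i < j then u0 i else if i = j then q j else u i) y)"
proof -
  let ?H = "\<lambda>j i. if i < j then u0 i else u i"
  let ?h = "\<lambda>j i. if i < j then u0 i else if i = j then q j else u i"
  let ?G = "\<lambda>u. iter_deriv m g u y"
  have "?G (?H j) - ?G (?H (Suc j)) = t *\<^sub>R ?G (?h j)" if j: "j < m" for j
  proof -
    have "?H j = (?h j)(j := u0 j + t *\<^sub>R q j)" "?H (Suc j) = (?h j)(j := u0 j)"
      "?h j = (?h j)(j := q j)"
      using step[OF j] by (auto simp: fun_eq_iff)
    then show ?thesis
      using iter_deriv_linear[OF g y j, of "?h j" "u0 j" t "q j"] by simp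
  qed
  then have "(\<Sum>j<m. t *\<^sub>R ?G (?h j)) = (\<Sum>j<m. ?G (?H j) - ?G (?H (Suc j)))"
    by simp
  also have "\<dots> = ?G (?H 0) - ?G (?H m)"
    by (rule sum_lessThan_telescope')
  also have "?H 0 = u" by simp
  also have "iter_deriv m g (?H m) = iter_deriv m g u0"
    by (rule iter_deriv_cong) simp
  finally show ?thesis by simp
qed

lemma composite_term_continuous:
  fixes f :: "'e::locally_convex_space \<Rightarrow> 'f::locally_convex_space"
    and g :: "'f \<Rightarrow> 'g::locally_convex_space"
  assumes f: "C_infinity_on U f" and g: "C_infinity_on V g" and sub: "f ` U \<subseteq> V"
    and p: "composite_term f g p"
  shows "continuous_on (U \<times> UNIV) (\<lambda>(x, v). p v x)"
  using p
proof induction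
  case (base m \<kappa> s)
  show ?case
    unfolding continuous_on_def
  proof
    fix z :: "'e \<times> (nat \<Rightarrow> 'e)" assume z: "z \<in> U \<times> UNIV"
    have f_lim: "((\<lambda>z. f (fst z)) \<longlongrightarrow> f (fst z)) (at z within U \<times> UNIV)"
      using C_infinity_on_continuous_select[OF f, of 0 id] z
      unfolding continuous_on_def by (force simp: case_prod_unfold)
    have "((\<lambda>z j. iter_deriv (\<kappa> j) f (snd z \<circ> s j) (fst z)) \<longlongrightarrow>
        (\<lambda>j. iter_deriv (\<kappa> j) f (snd z \<circ> s j) (fst z))) (at z within U \<times> UNIV)"
      using C_infinity_on_continuous_select[OF f] z
      by (intro tendsto_fun) (auto simp: continuous_on_def case_prod_unfold)
    then show "((\<lambda>(x, v). iter_deriv m g (\<lambda>j. iter_deriv (\<kappa> j) f (v \<circ> s j) x) (f x)) \<longlongrightarrow>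
        (case z of (x, v) \<Rightarrow> iter_deriv m g (\<lambda>j. iter_deriv (\<kappa> j) f (v \<circ> s j) x) (f x)))
        (at z within U \<times> UNIV)"
      unfolding case_prod_unfold using z sub
      by (intro C_infinity_on_tendsto[OF g _ f_lim]) auto
  qed
next
  case (add p q)
  then show ?case by (simp add: case_prod_unfold continuous_on_add)
qed simp

text \<open>For a basic term this is a product rule. \<open>q0\<close> comes from moving the base
  point \<open>f x\<close> and adds the slot \<open>m\<close>, filled with the first derivative of
  \<open>f\<close>; \<open>q1 j\<close> comes from moving the direction in slot \<open>j\<close>,
  whose inner derivative gains \<open>v n\<close> as a further direction.\<close>

lemma composite_term_deriv:
  fixes f :: "'e::locally_convex_space \<Rightarrow> 'f::locally_convex_space"
    and g :: "'f \<Rightarrow> 'g::locally_convex_space"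
  assumes f: "C_infinity_on U f" and g: "C_infinity_on V g" and sub: "f ` U \<subseteq> V"
    and p: "composite_term f g p"
  shows "\<exists>q. composite_term f g q \<and> (\<forall>v. \<forall>x\<in>U. (diff_quotient (p v) x (v n) \<longlongrightarrow> q v x) (at 0))"
  using p
proof induction
  case zero
  have "diff_quotient (\<lambda>x::'e. 0 :: 'g) = (\<lambda>x v t. 0)" by (simp add: fun_eq_iff diff_quotient_def)
  then show ?case by (intro exI[of _ "\<lambda>v x. 0"]) (auto intro: composite_term.zero)
next
  case (add p1 p2)
  then obtain q1 q2 where q: "composite_term f g q1" "composite_term f g q2"
    and lim: "\<And>v x. x \<in> U \<Longrightarrow> (diff_quotient (p1 v) x (v n) \<longlongrightarrow> q1 v x) (at 0)"
      "\<And>v x. x \<in> U \<Longrightarrow> (diff_quotient (p2 v) x (v n) \<longlongrightarrow> q2 v x) (at 0)"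
    by blast
  have "diff_quotient (\<lambda>x. p1 v x + p2 v x) x w = (\<lambda>t. diff_quotient (p1 v) x w t + diff_quotient (p2 v) x w t)"
    for v x w by (simp add: fun_eq_iff diff_quotient_def algebra_simps)
  then show ?case
    using composite_term.add[OF q] tendsto_add[OF lim]
    by (intro exI[of _ "\<lambda>v x. q1 v x + q2 v x"]) simp
next
  case (base m \<kappa> s)
  define u where "u v x j = iter_deriv (\<kappa> j) f (v \<circ> s j) x" for v x j
  define q0 where "q0 v x = iter_deriv (Suc m) g
    ((u v x)(m := iter_deriv (Suc 0) f (v \<circ> (\<lambda>_. n)) x)) (f x)" for v x
  define q1 where "q1 j v x = iter_deriv m g
    ((u v x)(j := iter_deriv (Suc (\<kappa> j)) f (v \<circ> (s j)(\<kappa> j := n)) x)) (f x)" for j v x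
  have "composite_term f g (\<lambda>v x. q0 v x + (\<Sum>j<m. q1 j v x))"
    unfolding q0_def q1_def u_def
    by (intro composite_term.add composite_term_sum composite_term_update)
  moreover have "(diff_quotient (\<lambda>x. iter_deriv m g (u v x) (f x)) x (v n)
      \<longlongrightarrow> q0 v x + (\<Sum>j<m. q1 j v x)) (at 0)" if x: "x \<in> U" for v x
  proof -
    define w where "w = diff_quotient f x (v n)"
    define q where "q j = diff_quotient (iter_deriv (\<kappa> j) f (v \<circ> s j)) x (v n)" for j
    define ut where "ut t = u v (x + t *\<^sub>R v n)" for t
    have fx: "f x \<in> V" using sub x by blast
    have "((\<lambda>t. x + t *\<^sub>R v n) \<longlongrightarrow> x + 0 *\<^sub>R v n) (at 0)"
      by (intro tendsto_intros tendsto_scaleR_lcs)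
    then have x_lim: "((\<lambda>t. x + t *\<^sub>R v n) \<longlongrightarrow> x) (at 0)" by simp
    have ut_lim: "((\<lambda>t. ut t j) \<longlongrightarrow> u v x j) (at 0)" for j
      unfolding u_def ut_def by (intro C_infinity_on_tendsto[OF f x x_lim] tendsto_const)
    have w_lim: "(w \<longlongrightarrow> iter_deriv (Suc 0) f (v \<circ> (\<lambda>_. n)) x) (at 0)"
      unfolding w_def using C_infinity_on_diff_quotient[OF f x] 
      by (simp add: iter_deriv.simps(1)[abs_def])
    have q_lim: "(q j \<longlongrightarrow> iter_deriv (Suc (\<kappa> j)) f (v \<circ> (s j)(\<kappa> j := n)) x) (at 0)" for j
      unfolding q_def by (rule C_infinity_on_deriv_select[OF f x])
    \<comment> \<open>The difference quotient of the term is split at the old base point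
      \<open>f x\<close> with the new directions \<open>ut t\<close>. In the first part the base
      point moves while the directions depend on \<open>t\<close>, hence the appeal to strict
      differentiability; the second part is the telescoping sum divided by \<open>t\<close>.\<close>
    have "((\<lambda>t. diff_quotient (iter_deriv m g (ut t)) (f x) (w t) t +
        (\<Sum>j<m. iter_deriv m g (\<lambda>i. if i < j then u v x i else if i = j then q j t else ut t i) (f x)))
        \<longlongrightarrow> q0 v x + (\<Sum>j<m. q1 j v x)) (at 0)"
      unfolding q0_def q1_def
    proof (intro tendsto_add tendsto_sum)
      show "((\<lambda>t. diff_quotient (iter_deriv m g (ut t)) (f x) (w t) t) \<longlongrightarrow>
          iter_deriv (Suc m) g ((u v x)(m := iter_deriv (Suc 0) f (v \<circ> (\<lambda>_. n)) x)) (f x)) (at 0)"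
        by (intro C_infinity_on_strict[OF g fx] tendsto_const tendsto_fun ut_lim w_lim tendsto_ident_at)
          (simp add: eventually_at_filter)
      fix j
      show "((\<lambda>t. iter_deriv m g (\<lambda>i. if i < j then u v x i else if i = j then q j t else ut t i) (f x))
          \<longlongrightarrow> iter_deriv m g ((u v x)(j := iter_deriv (Suc (\<kappa> j)) f (v \<circ> (s j)(\<kappa> j := n)) x)) (f x)) (at 0)"
      proof (intro C_infinity_on_tendsto[OF g fx tendsto_const] tendsto_fun)
        fix i
        show "((\<lambda>t. if i < j then u v x i else if i = j then q j t else ut t i) \<longlongrightarrow>
            ((u v x)(j := iter_deriv (Suc (\<kappa> j)) f (v \<circ> (s j)(\<kappa> j := n)) x)) i) (at 0)"
          using q_lim ut_lim
          by (cases i j rule: linorder_cases) (simp_all del: iter_deriv.simps)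
      qed
    qed
    then show ?thesis
    proof (rule Lim_transform_eventually)
      have "\<forall>\<^sub>F t in at (0::real). t \<noteq> 0" by (simp add: eventually_at_filter)
      then show "\<forall>\<^sub>F t in at 0. diff_quotient (iter_deriv m g (ut t)) (f x) (w t) t +
          (\<Sum>j<m. iter_deriv m g (\<lambda>i. if i < j then u v x i else if i = j then q j t else ut t i) (f x)) =
          diff_quotient (\<lambda>x. iter_deriv m g (u v x) (f x)) x (v n) t"
      proof eventually_elim
        case (elim t)
        have "iter_deriv m g (ut t) (f x) - iter_deriv m g (u v x) (f x) =
          (\<Sum>j<m. t *\<^sub>R iter_deriv m g (\<lambda>i. if i < j then u v x i else if i = j then q j t else ut t i) (f x))"
          by (rule iter_deriv_increment[OF g fx])
            (use elim in \<open>simp add: q_def u_def ut_def add_scaleR_diff_quotient\<close>)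
        then have eq1: "(iter_deriv m g (ut t) (f x) - iter_deriv m g (u v x) (f x)) /\<^sub>R t =
          (\<Sum>j<m. iter_deriv m g (\<lambda>i. if i < j then u v x i else if i = j then q j t else ut t i) (f x))"
          using elim by (simp add: scaleR_sum_right)
        have eq2: "diff_quotient (iter_deriv m g (ut t)) (f x) (w t) t =
            (iter_deriv m g (ut t) (f (x + t *\<^sub>R v n)) - iter_deriv m g (ut t) (f x)) /\<^sub>R t"
          using elim by (simp add: diff_quotient_def[of "iter_deriv m g (ut t)"] w_def add_scaleR_diff_quotient)
        have eq3: "diff_quotient (\<lambda>x. iter_deriv m g (u v x) (f x)) x (v n) t =
            (iter_deriv m g (ut t) (f (x + t *\<^sub>R v n)) - iter_deriv m g (u v x) (f x)) /\<^sub>R t"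
          by (simp add: diff_quotient_def ut_def)
        show ?case
          unfolding eq1[symmetric] eq2 eq3 by (simp add: scaleR_diff_right)
      qed
    qed
  qed
  ultimately show ?case unfolding u_def by blast
qed

lemma C_infinity_on_compose:
  assumes f: "C_infinity_on U f" and g: "C_infinity_on V g" and sub: "f ` U \<subseteq> V"
  shows "C_infinity_on U (g \<circ> f)"
proof (rule C_infinity_onI[where P = "composite_term f g"])
  show "open U" using f by (simp add: C_infinity_on_def)
  have "composite_term f g (\<lambda>v x. iter_deriv 0 g (\<lambda>j. iter_deriv 0 f (v \<circ> (\<lambda>_. 0)) x) (f x))"
    by (rule composite_term.base)
  then show "composite_term f g (\<lambda>v. g \<circ> f)" by (simp add: comp_def)
qed (use composite_term_continuous[OF assms] composite_term_deriv[OF assms] in auto)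

section \<open>Real analytic maps\<close>

lemma holomorphic_smooth_on_mult_i:
  "holomorphic_smooth_on U f \<Longrightarrow> z \<in> U \<Longrightarrow> dir_deriv f z (mult_i v) = mult_i (dir_deriv f z v)"
  unfolding holomorphic_smooth_on_def by blast

lemma holomorphic_smooth_on_compose:
  assumes f: "holomorphic_smooth_on U f" and g: "holomorphic_smooth_on V g" and sub: "f ` U \<subseteq> V"
  shows "holomorphic_smooth_on U (g \<circ> f)"
proof -
  have fg: "C_infinity_on U f" "C_infinity_on V g"
    using f g by (auto simp: holomorphic_smooth_on_def)
  have "dir_deriv (g \<circ> f) z (mult_i v) = mult_i (dir_deriv (g \<circ> f) z v)" if z: "z \<in> U" for z v
  proof -
    have "f z \<in> V" using z sub by blast
    then show ?thesis
      using z by (simp add: dir_deriv_compose[OF fg z] holomorphic_smooth_on_mult_i[OF f]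
          holomorphic_smooth_on_mult_i[OF g])
  qed
  then show ?thesis
    using C_infinity_on_compose[OF fg sub] by (simp add: holomorphic_smooth_on_def)
qed

lemma holomorphic_smooth_on_subset:
  "holomorphic_smooth_on U f \<Longrightarrow> open V \<Longrightarrow> V \<subseteq> U \<Longrightarrow> holomorphic_smooth_on V f"
  unfolding holomorphic_smooth_on_def by (blast intro: C_infinity_on_subset)

text \<open>Intersecting the domain of the extension with \<open>U \<times> UNIV\<close> puts all
  its real points over \<open>U\<close>, so that \<open>h\<close> extends \<open>f\<close> without a
  side condition on \<open>y\<close>.\<close>

lemma C_omega_onE:
  assumes "C_omega_on U f" "x \<in> U"
  obtains W h where "(x, 0) \<in> W" "open W" "holomorphic_smooth_on W h" "fst ` W \<subseteq> U"
    "\<And>y. (y, 0) \<in> W \<Longrightarrow> h (y, 0) = (f y, 0)"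
proof -
  obtain W h where W: "(x, 0) \<in> W" "holomorphic_smooth_on W h"
    "\<And>y. y \<in> U \<Longrightarrow> (y, 0) \<in> W \<Longrightarrow> h (y, 0) = (f y, 0)" and U: "open U"
    using assms unfolding C_omega_on_def by blast
  then have "open (W \<inter> U \<times> UNIV)"
    by (auto simp: holomorphic_smooth_on_def C_infinity_on_def intro!: open_Int open_Times)
  then show ?thesis
    using W assms(2)
    by (intro that[of "W \<inter> U \<times> UNIV" h]) (auto intro: holomorphic_smooth_on_subset)
qed

lemma C_omega_onI:
  assumes "open U"
    and "\<And>x. x \<in> U \<Longrightarrow> \<exists>W h. (x, 0) \<in> W \<and> holomorphic_smooth_on W h \<and>
       (\<forall>y. (y, 0) \<in> W \<longrightarrow> h (y, 0) = (f y, 0))"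
  shows "C_omega_on U f"
  using assms(1) assms(2) unfolding C_omega_on_def by (intro conjI ballI) meson+

lemma C_omega_on_cong:
  assumes "C_omega_on U f" "\<And>x. x \<in> U \<Longrightarrow> f x = g x"
  shows "C_omega_on U g"
proof (rule C_omega_onI)
  show "open U" using assms by (simp add: C_omega_on_def)
  fix x assume "x \<in> U"
  from C_omega_onE[OF assms(1) this] obtain W h where
    "(x, 0) \<in> W" "holomorphic_smooth_on W h" "fst ` W \<subseteq> U" "\<And>y. (y, 0) \<in> W \<Longrightarrow> h (y, 0) = (f y, 0)"
    by metis
  moreover from this have "\<forall>y. (y, 0) \<in> W \<longrightarrow> h (y, 0) = (g y, 0)"
    using assms(2) by (metis fst_conv image_subset_iff)
  ultimately show "\<exists>W h. (x, 0) \<in> W \<and> holomorphic_smooth_on W h \<and>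
      (\<forall>y. (y, 0) \<in> W \<longrightarrow> h (y, 0) = (g y, 0))"
    by blast
qed

lemma C_omega_on_Union:
  assumes "\<And>V. V \<in> \<V> \<Longrightarrow> C_omega_on V f"
  shows "C_omega_on (\<Union>\<V>) f"
proof (rule C_omega_onI)
  show "open (\<Union>\<V>)" using assms by (auto simp: C_omega_on_def)
  fix x assume "x \<in> \<Union>\<V>"
  then obtain V where V: "V \<in> \<V>" "x \<in> V" by blast
  from C_omega_onE[OF assms[OF V(1)] V(2)]
  show "\<exists>W h. (x, 0) \<in> W \<and> holomorphic_smooth_on W h \<and> (\<forall>y. (y, 0) \<in> W \<longrightarrow> h (y, 0) = (f y, 0))"
    by metis
qed

lemma C_omega_on_subset:
  assumes "C_omega_on U f" "open V" "V \<subseteq> U"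
  shows "C_omega_on V f"
  using assms unfolding C_omega_on_def by blast

text \<open>Local extensions compose on the preimage of \<open>W'\<close> under \<open>h\<close>,
  which is open because \<open>h\<close> is continuous.\<close>

lemma C_omega_on_compose:
  assumes f: "C_omega_on U f" and g: "C_omega_on V g" and sub: "f ` U \<subseteq> V"
  shows "C_omega_on U (g \<circ> f)"
proof (rule C_omega_onI)
  show "open U" using f by (simp add: C_omega_on_def)
  fix x assume x: "x \<in> U"
  obtain W h where W: "(x, 0) \<in> W" "open W" "holomorphic_smooth_on W h"
    "\<And>y. (y, 0) \<in> W \<Longrightarrow> h (y, 0) = (f y, 0)"
    using C_omega_onE[OF f x] by metis
  have "f x \<in> V" using x sub by blast
  from C_omega_onE[OF g this] obtain W' h' where W': "(f x, 0) \<in> W'" "open W'"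
    "holomorphic_smooth_on W' h'" "\<And>y. (y, 0) \<in> W' \<Longrightarrow> h' (y, 0) = (g y, 0)"
    by metis
  have "continuous_on W h"
    using W(3) by (auto simp: holomorphic_smooth_on_def intro: C_infinity_on_imp_continuous_on)
  then have "open (W \<inter> h -` W')"
    using W(2) W'(2) by (rule continuous_open_preimage)
  then have "holomorphic_smooth_on (W \<inter> h -` W') (h' \<circ> h)"
    by (intro holomorphic_smooth_on_compose[OF holomorphic_smooth_on_subset[OF W(3)] W'(3)]) auto
  moreover have "(x, 0) \<in> W \<inter> h -` W'" using W W' by simp
  moreover have "(h' \<circ> h) (y, 0) = ((g \<circ> f) y, 0)" if "(y, 0) \<in> W \<inter> h -` W'" for y
    using that W(4)[of y] W'(4)[of "f y"] by simp
  ultimately show "\<exists>W k. (x, 0) \<in> W \<and> holomorphic_smooth_on W k \<and>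
      (\<forall>y. (y, 0) \<in> W \<longrightarrow> k (y, 0) = ((g \<circ> f) y, 0))"
    by (intro exI[of _ "W \<inter> h -` W'"] exI[of _ "h' \<circ> h"]) simp
qed

lemma C_omega_on_affine:
  fixes L :: "'e::locally_convex_space \<Rightarrow> 'f::locally_convex_space"
  assumes U: "open U" and L: "linear L" and cont: "continuous_on UNIV L"
  shows "C_omega_on U (\<lambda>x. L x + c)"
proof (rule C_omega_onI[OF U])
  fix x
  \<comment> \<open>The complexification of \<open>L\<close>. The constant is real, so the extension
    translates by \<open>(c, 0)\<close>.\<close>
  let ?L = "map_prod L L"
  have lin: "linear ?L"
    by (rule linearI) (auto simp: linear_add[OF L] linear_scale[OF L] map_prod_def case_prod_unfold)
  have "continuous_on UNIV (\<lambda>z. (L (fst z), L (snd z)))"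
    by (intro continuous_intros continuous_on_compose2[OF cont]) auto
  then have "C_infinity_on UNIV (\<lambda>z. ?L z + (c, 0))"
    by (intro C_infinity_on_affine lin) (simp_all add: map_prod_def case_prod_unfold)
  moreover have "dir_deriv (\<lambda>z. ?L z + (c, 0)) z v = ?L v" for z v
    by (intro dir_deriv_eqI diff_quotient_affine lin)
  then have "dir_deriv (\<lambda>z. ?L z + (c, 0)) z (mult_i v) = mult_i (dir_deriv (\<lambda>z. ?L z + (c, 0)) z v)" for z v
    by (simp add: mult_i_def map_prod_def case_prod_unfold linear_neg[OF L])
  ultimately have "holomorphic_smooth_on UNIV (\<lambda>z. ?L z + (c, 0))"
    by (simp add: holomorphic_smooth_on_def)
  moreover have "?L (y, 0) + (c, 0) = (L y + c, 0)" for y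
    by (simp add: linear_0[OF L])
  ultimately show "\<exists>W h. (x, 0) \<in> W \<and> holomorphic_smooth_on W h \<and>
      (\<forall>y. (y, 0) \<in> W \<longrightarrow> h (y, 0) = (L y + c, 0))"
    by (intro exI[of _ UNIV] exI[of _ "\<lambda>z. ?L z + (c, 0)"]) auto
qed

text \<open>The pair of two extensions takes values in a product of complexifications, while the
  complexification of the product groups real and imaginary parts. The continuous linear map
  \<open>M\<close> is this reshuffling.\<close>

lemma holomorphic_smooth_on_Pair:
  fixes f :: "'e::locally_convex_space \<times> 'e \<Rightarrow> 'f::locally_convex_space \<times> 'f"
    and g :: "'e \<times> 'e \<Rightarrow> 'g::locally_convex_space \<times> 'g"
  assumes f: "holomorphic_smooth_on U f" and g: "holomorphic_smooth_on U g"
  shows "holomorphic_smooth_on U (\<lambda>z. ((fst (f z), fst (g z)), (snd (f z), snd (g z))))"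
proof -
  have fg: "C_infinity_on U f" "C_infinity_on U g"
    using f g by (auto simp: holomorphic_smooth_on_def)
  define M :: "('f \<times> 'f) \<times> ('g \<times> 'g) \<Rightarrow> ('f \<times> 'g) \<times> ('f \<times> 'g)"
    where "M p = ((fst (fst p), fst (snd p)), (snd (fst p), snd (snd p)))" for p
  have "linear M" by (rule linearI) (auto simp: M_def)
  moreover have "continuous_on UNIV M"
    unfolding M_def[abs_def] by (intro continuous_intros)
  ultimately have "C_infinity_on UNIV (\<lambda>p. M p + 0)"
    by (intro C_infinity_on_affine) auto
  then have "C_infinity_on U (M \<circ> (\<lambda>z. (f z, g z)))"
    by (intro C_infinity_on_compose[OF C_infinity_on_Pair[OF fg]]) auto
  then have "C_infinity_on U (\<lambda>z. ((fst (f z), fst (g z)), (snd (f z), snd (g z))))"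
    by (simp add: M_def comp_def)
  moreover have "dir_deriv (\<lambda>z. ((fst (f z), fst (g z)), (snd (f z), snd (g z)))) z v =
      ((fst (dir_deriv f z v), fst (dir_deriv g z v)), (snd (dir_deriv f z v), snd (dir_deriv g z v)))"
    if z: "z \<in> U" for z v
  proof (rule dir_deriv_eqI)
    have "diff_quotient (\<lambda>z. ((fst (f z), fst (g z)), (snd (f z), snd (g z)))) z v =
        (\<lambda>t. ((fst (diff_quotient f z v t), fst (diff_quotient g z v t)),
              (snd (diff_quotient f z v t), snd (diff_quotient g z v t))))"
      by (simp add: diff_quotient_def fun_eq_iff)
    then show "(diff_quotient (\<lambda>z. ((fst (f z), fst (g z)), (snd (f z), snd (g z)))) z v \<longlongrightarrow>
      ((fst (dir_deriv f z v), fst (dir_deriv g z v)), (snd (dir_deriv f z v), snd (dir_deriv g z v)))) (at 0)"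
      by (simp only:) (intro tendsto_Pair tendsto_fst tendsto_snd C_infinity_on_diff_quotient[OF _ z] fg)
  qed
  moreover note holomorphic_smooth_on_mult_i[OF f] holomorphic_smooth_on_mult_i[OF g]
  ultimately show ?thesis
    unfolding holomorphic_smooth_on_def by (simp add: mult_i_def del: split_paired_All)
qed

lemma C_omega_on_Pair:
  assumes f: "C_omega_on U f" and g: "C_omega_on U g"
  shows "C_omega_on U (\<lambda>x. (f x, g x))"
proof (rule C_omega_onI)
  show "open U" using f by (simp add: C_omega_on_def)
  fix x assume x: "x \<in> U"
  obtain W h where W: "(x, 0) \<in> W" "open W" "holomorphic_smooth_on W h"
    "\<And>y. (y, 0) \<in> W \<Longrightarrow> h (y, 0) = (f y, 0)"
    using C_omega_onE[OF f x] by metis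
  obtain W' h' where W': "(x, 0) \<in> W'" "open W'" "holomorphic_smooth_on W' h'"
    "\<And>y. (y, 0) \<in> W' \<Longrightarrow> h' (y, 0) = (g y, 0)"
    using C_omega_onE[OF g x] by metis
  let ?h = "\<lambda>z. ((fst (h z), fst (h' z)), (snd (h z), snd (h' z)))"
  have "holomorphic_smooth_on (W \<inter> W') ?h"
    using W(2,3) W'(2,3) by (intro holomorphic_smooth_on_Pair) (auto intro: holomorphic_smooth_on_subset)
  moreover have "\<forall>y. (y, 0) \<in> W \<inter> W' \<longrightarrow> ?h (y, 0) = ((f y, g y), 0)"
    using W(4) W'(4) by (simp add: zero_prod_def)
  ultimately show "\<exists>W k. (x, 0) \<in> W \<and> holomorphic_smooth_on W k \<and>
      (\<forall>y. (y, 0) \<in> W \<longrightarrow> k (y, 0) = ((f y, g y), 0))"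
    using W(1) W'(1) by (intro exI[of _ "W \<inter> W'"] exI[of _ ?h]) simp
qed

lemma C_omega_on_imp_continuous_on:
  assumes "C_omega_on U f"
  shows "continuous_on U f"
  unfolding continuous_on_def
proof
  fix x assume x: "x \<in> U"
  obtain W h where W: "(x, 0) \<in> W" "open W" "holomorphic_smooth_on W h" 
    "\<And>y. (y, 0) \<in> W \<Longrightarrow> h (y, 0) = (f y, 0)"
    using C_omega_onE[OF assms x] by metis
  have "continuous_on W h"
    using W(3) by (auto simp: holomorphic_smooth_on_def intro: C_infinity_on_imp_continuous_on)
  moreover have lim: "((\<lambda>y. (y, 0)) \<longlongrightarrow> (x, 0)) (at x within U)"
    by (intro tendsto_intros)
  moreover have ev: "\<forall>\<^sub>F y in at x within U. (y, 0) \<in> W"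
    using topological_tendstoD[OF lim W(2,1)] .
  ultimately have "((\<lambda>y. h (y, 0)) \<longlongrightarrow> h (x, 0)) (at x within U)"
    using W(1) continuous_on_tendsto_compose by blast
  then have "((\<lambda>y. fst (h (y, 0))) \<longlongrightarrow> f x) (at x within U)"
    using tendsto_fst W(1,4) by fastforce
  then show "(f \<longlongrightarrow> f x) (at x within U)"
    by (rule Lim_transform_eventually) (use ev W(4) in \<open>auto elim: eventually_mono\<close>)
qed

section \<open>Properties shared by both smoothness classes\<close>

lemma smooth_on_open: "smooth_on r U f \<Longrightarrow> open U"
  by (cases r) (auto simp: C_infinity_on_def C_omega_on_def)

lemma smooth_on_continuous: "smooth_on r U f \<Longrightarrow> continuous_on U f"
  by (cases r) (auto intro: C_infinity_on_imp_continuous_on C_omega_on_imp_continuous_on)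

lemma smooth_on_cong:
  assumes "smooth_on r U f" "\<And>x. x \<in> U \<Longrightarrow> f x = g x"
  shows "smooth_on r U g"
  using assms(1) C_infinity_on_cong[OF _ assms(2)] C_omega_on_cong[OF _ assms(2)] by (cases r) auto

lemma smooth_on_subset: "smooth_on r U f \<Longrightarrow> open V \<Longrightarrow> V \<subseteq> U \<Longrightarrow> smooth_on r V f"
  by (cases r) (auto intro: C_infinity_on_subset C_omega_on_subset)

lemma smooth_on_Union: "(\<And>V. V \<in> \<V> \<Longrightarrow> smooth_on r V f) \<Longrightarrow> smooth_on r (\<Union>\<V>) f"
  by (cases r) (auto intro: C_infinity_on_Union C_omega_on_Union)

lemma smooth_on_compose:
  "smooth_on r U f \<Longrightarrow> smooth_on r V g \<Longrightarrow> f ` U \<subseteq> V \<Longrightarrow> smooth_on r U (g \<circ> f)"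
  by (cases r) (simp_all add: C_infinity_on_compose C_omega_on_compose)

lemma smooth_on_Pair:
  "smooth_on r U f \<Longrightarrow> smooth_on r U g \<Longrightarrow> smooth_on r U (\<lambda>x. (f x, g x))"
  by (cases r) (auto intro: C_infinity_on_Pair C_omega_on_Pair)

lemma smooth_on_affine:
  "open U \<Longrightarrow> linear L \<Longrightarrow> continuous_on UNIV L \<Longrightarrow> smooth_on r U (\<lambda>x. L x + c)"
  by (cases r) (auto intro: C_infinity_on_affine C_omega_on_affine)

lemma smooth_on_const: "open U \<Longrightarrow> smooth_on r U (\<lambda>x. c)"
  using smooth_on_affine[of U "\<lambda>x. 0" r c] by (simp add: linear_zero)

lemma smooth_on_fst: "open U \<Longrightarrow> smooth_on r U fst"
  using smooth_on_affine[of U fst r 0] by (simp add: linear_iff continuous_on_fst continuous_on_id)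

lemma smooth_on_snd: "open U \<Longrightarrow> smooth_on r U snd"
  using smooth_on_affine[of U snd r 0] by (simp add: linear_iff continuous_on_snd continuous_on_id)

lemma smooth_onI:
  assumes "\<And>x. x \<in> U \<Longrightarrow> \<exists>V. x \<in> V \<and> V \<subseteq> U \<and> smooth_on r V f"
  shows "smooth_on r U f"
proof -
  have *: "\<Union>{V. V \<subseteq> U \<and> smooth_on r V f} = U" using assms by blast
  have "smooth_on r (\<Union>{V. V \<subseteq> U \<and> smooth_on r V f}) f"
    by (rule smooth_on_Union) simp
  then show ?thesis unfolding * .
qed

section \<open>Smooth maps between manifolds\<close>

text \<open>The part of the manifold axioms that the composition of smooth maps uses. Unlike
  \<open>manifold\<close>, it passes to products and restrictions without any statement about
  transition maps.\<close>

definition injective_atlas :: "'a topology \<Rightarrow> ('a, 'e) chart set \<Rightarrow> bool"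
  where "injective_atlas X A \<longleftrightarrow>
    (\<forall>(U, \<phi>)\<in>A. U \<subseteq> topspace X \<and> inj_on \<phi> U) \<and> topspace X \<subseteq> (\<Union>c\<in>A. fst c)"

lemma injective_atlasD:
  assumes "injective_atlas X A" "(U, \<phi>) \<in> A"
  shows "U \<subseteq> topspace X" "inj_on \<phi> U"
  using assms unfolding injective_atlas_def by blast+

lemma injective_atlas_coverE:
  assumes "injective_atlas X A" "x \<in> topspace X"
  obtains U \<phi> where "(U, \<phi>) \<in> A" "x \<in> U"
proof -
  obtain c where "c \<in> A" "x \<in> fst c"
    using assms unfolding injective_atlas_def by blast
  then show ?thesis using that[of "fst c" "snd c"] by simp
qed

lemma is_chartD:
  assumes "is_chart X (U, \<phi>)"
  shows "openin X U" "open (\<phi> ` U)" "inj_on \<phi> U" "U \<subseteq> topspace X"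
    "homeomorphic_map (subtopology X U) (top_of_set (\<phi> ` U)) \<phi>"
proof -
  show *: "openin X U" "open (\<phi> ` U)" "homeomorphic_map (subtopology X U) (top_of_set (\<phi> ` U)) \<phi>"
    using assms by (auto simp: is_chart_def)
  show U: "U \<subseteq> topspace X" using *(1) by (rule openin_subset)
  show "inj_on \<phi> U"
    using homeomorphic_imp_injective_map[OF *(3)] U by (simp add: topspace_subtopology Int_absorb1)
qed

lemma manifold_chart: "manifold r X A \<Longrightarrow> c \<in> A \<Longrightarrow> is_chart X c"
  by (simp add: manifold_def)

lemma manifold_imp_injective_atlas:
  assumes "manifold r X A"
  shows "injective_atlas X A"
  unfolding injective_atlas_def
proof (intro conjI ballI)
  fix c assume "c \<in> A"
  then have "is_chart X c" using assms by (rule manifold_chart[rotated])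
  then show "case c of (U, \<phi>) \<Rightarrow> U \<subseteq> topspace X \<and> inj_on \<phi> U"
    by (cases c) (simp add: is_chartD)
qed (use assms in \<open>simp add: manifold_def\<close>)

lemma injective_atlas_prod:
  assumes "injective_atlas X A" "injective_atlas Y B"
  shows "injective_atlas (prod_topology X Y) (prod_atlas A B)"
  unfolding injective_atlas_def
proof (intro conjI ballI subsetI)
  fix c assume "c \<in> prod_atlas A B"
  then obtain U \<phi> V \<psi> where c: "c = (U \<times> V, map_prod \<phi> \<psi>)" "(U, \<phi>) \<in> A" "(V, \<psi>) \<in> B"
    by (auto simp: prod_atlas_def)
  then show "case c of (U, \<phi>) \<Rightarrow> U \<subseteq> topspace (prod_topology X Y) \<and> inj_on \<phi> U"
    using injective_atlasD[OF assms(1) c(2)] injective_atlasD[OF assms(2) c(3)]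
    by (auto intro: map_prod_inj_on)
next
  fix p assume "p \<in> topspace (prod_topology X Y)"
  then obtain x y where p: "p = (x, y)" "x \<in> topspace X" "y \<in> topspace Y" by auto
  obtain U \<phi> where U: "(U, \<phi>) \<in> A" "x \<in> U" using injective_atlas_coverE[OF assms(1) p(2)] .
  obtain V \<psi> where V: "(V, \<psi>) \<in> B" "y \<in> V" using injective_atlas_coverE[OF assms(2) p(3)] .
  have "(U \<times> V, map_prod \<phi> \<psi>) \<in> prod_atlas A B"
    using U V by (force simp: prod_atlas_def)
  then show "p \<in> (\<Union>c\<in>prod_atlas A B. fst c)"
    using U V p(1) by force
qed

lemma injective_atlas_restrict:
  assumes "injective_atlas X A"
  shows "injective_atlas (subtopology X W) (restrict_atlas A W)"
  unfolding injective_atlas_def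
proof (intro conjI ballI subsetI)
  fix c assume "c \<in> restrict_atlas A W"
  then obtain U \<phi> where c: "c = (U \<inter> W, \<phi>)" "(U, \<phi>) \<in> A" by (auto simp: restrict_atlas_def)
  then show "case c of (U, \<phi>) \<Rightarrow> U \<subseteq> topspace (subtopology X W) \<and> inj_on \<phi> U"
    using injective_atlasD[OF assms c(2)] by (auto simp: topspace_subtopology inj_on_def)
next
  fix x assume x: "x \<in> topspace (subtopology X W)"
  then obtain U \<phi> where U: "(U, \<phi>) \<in> A" "x \<in> U"
    using injective_atlas_coverE[OF assms] by (auto simp: topspace_subtopology)
  then have "(U \<inter> W, \<phi>) \<in> restrict_atlas A W" by (force simp: restrict_atlas_def)
  then show "x \<in> (\<Union>c\<in>restrict_atlas A W. fst c)"
    using U(2) x by (force simp: topspace_subtopology)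
qed

lemma smooth_map_continuous: "smooth_map r X A Y B f \<Longrightarrow> continuous_map X Y f"
  by (simp add: smooth_map_def)

lemma smooth_mapD:
  "smooth_map r X A Y B f \<Longrightarrow> (U, \<phi>) \<in> A \<Longrightarrow> (V, \<psi>) \<in> B \<Longrightarrow>
    smooth_on r (\<phi> ` {x\<in>U. f x \<in> V}) (\<psi> \<circ> f \<circ> inv_into U \<phi>)"
  unfolding smooth_map_def by blast

lemma smooth_mapI:
  assumes "continuous_map X Y f"
    and "\<And>U \<phi> V \<psi>. (U, \<phi>) \<in> A \<Longrightarrow> (V, \<psi>) \<in> B \<Longrightarrow>
      smooth_on r (\<phi> ` {x\<in>U. f x \<in> V}) (\<psi> \<circ> f \<circ> inv_into U \<phi>)"
  shows "smooth_map r X A Y B f"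
  using assms unfolding smooth_map_def by auto

lemma smooth_map_cong:
  assumes f: "smooth_map r X A Y B f" and A: "injective_atlas X A"
    and eq: "\<And>x. x \<in> topspace X \<Longrightarrow> f x = g x"
  shows "smooth_map r X A Y B g"
proof (rule smooth_mapI)
  show "continuous_map X Y g"
    using smooth_map_continuous[OF f] eq by (rule continuous_map_eq)
  fix U \<phi> V \<psi> assume c: "(U, \<phi>) \<in> A" "(V, \<psi>) \<in> B"
  note U = injective_atlasD[OF A c(1)]
  have "{x\<in>U. g x \<in> V} = {x\<in>U. f x \<in> V}" using U(1) eq by auto
  moreover have "smooth_on r (\<phi> ` {x\<in>U. f x \<in> V}) (\<psi> \<circ> g \<circ> inv_into U \<phi>)"
    using smooth_mapD[OF f c] by (rule smooth_on_cong) (use U eq in \<open>auto simp: inv_into_f_f\<close>)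
  ultimately show "smooth_on r (\<phi> ` {x\<in>U. g x \<in> V}) (\<psi> \<circ> g \<circ> inv_into U \<phi>)" by simp
qed

text \<open>Around each point a chart of the middle space is inserted. The representatives compose
  on the set \<open>?T\<close> where that of \<open>f\<close> lands in the domain of that of
  \<open>g\<close>; it is open because the former is continuous with open domain and the latter has
  open domain.\<close>

lemma smooth_map_compose:
  assumes f: "smooth_map r X A Y B f" and g: "smooth_map r Y B Z C g"
    and A: "injective_atlas X A" and B: "injective_atlas Y B"
  shows "smooth_map r X A Z C (g \<circ> f)"
proof (rule smooth_mapI)
  show "continuous_map X Z (g \<circ> f)"
    using smooth_map_continuous[OF f] smooth_map_continuous[OF g] by (rule continuous_map_compose)
  fix U \<phi> W \<theta> assume U: "(U, \<phi>) \<in> A" and W: "(W, \<theta>) \<in> C"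
  note \<phi> = injective_atlasD[OF A U]
  show "smooth_on r (\<phi> ` {x\<in>U. (g \<circ> f) x \<in> W}) (\<theta> \<circ> (g \<circ> f) \<circ> inv_into U \<phi>)"
  proof (rule smooth_onI)
    fix z assume "z \<in> \<phi> ` {x\<in>U. (g \<circ> f) x \<in> W}"
    then obtain x where x: "z = \<phi> x" "x \<in> U" "g (f x) \<in> W" by auto
    then have "f x \<in> topspace Y"
      using smooth_map_continuous[OF f] \<phi>(1) by (auto simp: continuous_map_def)
    then obtain V \<psi> where V: "(V, \<psi>) \<in> B" "f x \<in> V" by (rule injective_atlas_coverE[OF B])
    note \<psi> = injective_atlasD[OF B V(1)]
    let ?O = "\<phi> ` {x\<in>U. f x \<in> V}" and ?P = "\<psi> ` {y\<in>V. g y \<in> W}"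
    let ?f = "\<psi> \<circ> f \<circ> inv_into U \<phi>" and ?g = "\<theta> \<circ> g \<circ> inv_into V \<psi>"
    note fs = smooth_mapD[OF f U V(1)] and gs = smooth_mapD[OF g V(1) W]
    let ?T = "?O \<inter> ?f -` ?P"
    have T: "\<exists>x. x \<in> U \<and> f x \<in> V \<and> g (f x) \<in> W \<and> w = \<phi> x" if w: "w \<in> ?T" for w
    proof -
      obtain x where x: "x \<in> U" "f x \<in> V" "w = \<phi> x" using w by blast
      then have "\<psi> (f x) \<in> ?P" using w by (simp add: inv_into_f_f[OF \<phi>(2)])
      then obtain y where "y \<in> V" "g y \<in> W" "\<psi> (f x) = \<psi> y" by auto
      then show ?thesis using x inj_onD[OF \<psi>(2)] by metis
    qed
    have "open ?T"
      by (intro continuous_open_preimage smooth_on_continuous[OF fs] smooth_on_open[OF fs] smooth_on_open[OF gs])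
    then have "smooth_on r ?T (?g \<circ> ?f)"
      by (intro smooth_on_compose[OF smooth_on_subset[OF fs] gs]) auto
    then have "smooth_on r ?T (\<theta> \<circ> (g \<circ> f) \<circ> inv_into U \<phi>)"
    proof (rule smooth_on_cong)
      fix w assume "w \<in> ?T"
      then obtain x where "x \<in> U" "f x \<in> V" "w = \<phi> x" using T by blast
      then show "(?g \<circ> ?f) w = (\<theta> \<circ> (g \<circ> f) \<circ> inv_into U \<phi>) w"
        by (simp add: inv_into_f_f[OF \<phi>(2)] inv_into_f_f[OF \<psi>(2)])
    qed
    moreover have "z \<in> ?T" using x V(2) by (auto simp: inv_into_f_f[OF \<phi>(2)])
    moreover have "?T \<subseteq> \<phi> ` {x\<in>U. (g \<circ> f) x \<in> W}" using T by fastforce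
    ultimately show "\<exists>V. z \<in> V \<and> V \<subseteq> \<phi> ` {x\<in>U. (g \<circ> f) x \<in> W} \<and>
        smooth_on r V (\<theta> \<circ> (g \<circ> f) \<circ> inv_into U \<phi>)"
      by (intro exI[of _ ?T] conjI)
  qed
qed

lemma smooth_map_Pair:
  assumes f: "smooth_map r X A Y B f" and g: "smooth_map r X A Z C g" and A: "injective_atlas X A"
  shows "smooth_map r X A (prod_topology Y Z) (prod_atlas B C) (\<lambda>x. (f x, g x))"
proof (rule smooth_mapI)
  show "continuous_map X (prod_topology Y Z) (\<lambda>x. (f x, g x))"
    using smooth_map_continuous[OF f] smooth_map_continuous[OF g] by (simp add: continuous_map_pairedI)
  fix U \<phi> W \<theta> assume U: "(U, \<phi>) \<in> A" and "(W, \<theta>) \<in> prod_atlas B C"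
  then obtain V1 \<psi>1 V2 \<psi>2 where W: "W = V1 \<times> V2" "\<theta> = map_prod \<psi>1 \<psi>2"
    and V: "(V1, \<psi>1) \<in> B" "(V2, \<psi>2) \<in> C"
    by (auto simp: prod_atlas_def)
  note \<phi> = injective_atlasD[OF A U]
  have eq: "\<phi> ` {x\<in>U. (f x, g x) \<in> W} = \<phi> ` {x\<in>U. f x \<in> V1} \<inter> \<phi> ` {x\<in>U. g x \<in> V2}"
    using \<phi>(2) unfolding W by (auto simp: inj_on_def)
  note fs = smooth_mapD[OF f U V(1)] and gs = smooth_mapD[OF g U V(2)]
  have "open (\<phi> ` {x\<in>U. (f x, g x) \<in> W})"
    unfolding eq by (intro open_Int smooth_on_open[OF fs] smooth_on_open[OF gs])
  then have "smooth_on r (\<phi> ` {x\<in>U. (f x, g x) \<in> W})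
      (\<lambda>x. ((\<psi>1 \<circ> f \<circ> inv_into U \<phi>) x, (\<psi>2 \<circ> g \<circ> inv_into U \<phi>) x))"
    by (intro smooth_on_Pair smooth_on_subset[OF fs] smooth_on_subset[OF gs]) (simp_all add: eq)
  then show "smooth_on r (\<phi> ` {x\<in>U. (f x, g x) \<in> W}) (\<theta> \<circ> (\<lambda>x. (f x, g x)) \<circ> inv_into U \<phi>)"
    by (simp add: W comp_def)
qed

text \<open>The local representatives of the identity are exactly the transition maps.\<close>

lemma smooth_map_id:
  assumes "manifold r X A"
  shows "smooth_map r X A X A (\<lambda>x. x)"
proof (rule smooth_mapI)
  fix U \<phi> V \<psi> assume "(U, \<phi>) \<in> A" "(V, \<psi>) \<in> A"
  then have "smooth_transition r (U, \<phi>) (V, \<psi>)" using assms by (simp add: manifold_def)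
  then show "smooth_on r (\<phi> ` {x\<in>U. x \<in> V}) (\<psi> \<circ> (\<lambda>x. x) \<circ> inv_into U \<phi>)"
    by (simp add: smooth_transition_def Int_def comp_def)
qed simp

lemma smooth_map_const:
  assumes A: "manifold r X A" and y: "y \<in> topspace Y"
  shows "smooth_map r X A Y B (\<lambda>x. y)"
proof (rule smooth_mapI)
  fix U \<phi> V \<psi> assume c: "(U, \<phi>) \<in> A" "(V, \<psi>) \<in> B"
  have "open (\<phi> ` {x\<in>U. y \<in> V})"
    using is_chartD(2)[OF manifold_chart[OF A c(1)]] by (cases "y \<in> V") auto
  then show "smooth_on r (\<phi> ` {x\<in>U. y \<in> V}) (\<psi> \<circ> (\<lambda>x. y) \<circ> inv_into U \<phi>)"
    by (simp add: comp_def smooth_on_const)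
qed (simp add: y)

text \<open>In charts this is the linear projection followed by a transition map of
  \<open>X\<close>.\<close>

lemma smooth_map_fst:
  assumes A: "manifold r X A" and B: "manifold r Y B"
  shows "smooth_map r (prod_topology X Y) (prod_atlas A B) X A fst"
proof (rule smooth_mapI)
  fix W \<theta> U' \<phi>' assume "(W, \<theta>) \<in> prod_atlas A B" and U': "(U', \<phi>') \<in> A"
  then obtain U \<phi> V \<psi> where W: "W = U \<times> V" "\<theta> = map_prod \<phi> \<psi>"
    and U: "(U, \<phi>) \<in> A" and V: "(V, \<psi>) \<in> B"
    by (auto simp: prod_atlas_def)
  note \<phi> = is_chartD[OF manifold_chart[OF A U]] and \<psi> = is_chartD[OF manifold_chart[OF B V]]
  have inj: "inj_on \<theta> W" unfolding W by (rule map_prod_inj_on[OF \<phi>(3) \<psi>(3)])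
  note ts = smooth_mapD[OF smooth_map_id[OF A] U U']
  have eq: "\<theta> ` {x\<in>W. fst x \<in> U'} = \<phi> ` {x\<in>U. x \<in> U'} \<times> \<psi> ` V"
    unfolding W by (auto simp: image_iff) 
  have "open (\<phi> ` {x\<in>U. x \<in> U'} \<times> \<psi> ` V)"
    by (intro open_Times smooth_on_open[OF ts] \<psi>(2))
  then have "smooth_on r (\<phi> ` {x\<in>U. x \<in> U'} \<times> \<psi> ` V) ((\<phi>' \<circ> (\<lambda>x. x) \<circ> inv_into U \<phi>) \<circ> fst)"
    by (intro smooth_on_compose[OF smooth_on_fst ts]) auto
  then show "smooth_on r (\<theta> ` {x\<in>W. fst x \<in> U'}) (\<phi>' \<circ> fst \<circ> inv_into W \<theta>)"
    unfolding eq[symmetric]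
  proof (rule smooth_on_cong)
    fix z assume "z \<in> \<theta> ` {x\<in>W. fst x \<in> U'}"
    then obtain x where x: "x \<in> W" "z = \<theta> x" by blast
    have "inv_into U \<phi> (\<phi> (fst x)) = fst x" using x(1) by (simp add: W \<phi>(3) mem_Times_iff)
    then show "((\<phi>' \<circ> (\<lambda>x. x) \<circ> inv_into U \<phi>) \<circ> fst) z = (\<phi>' \<circ> fst \<circ> inv_into W \<theta>) z"
      using x by (simp add: inv_into_f_f[OF inj]) (simp add: W)
  qed
qed (simp add: continuous_map_fst)

lemma smooth_map_snd:
  assumes A: "manifold r X A" and B: "manifold r Y B"
  shows "smooth_map r (prod_topology X Y) (prod_atlas A B) Y B snd"
proof (rule smooth_mapI)
  fix W \<theta> V' \<psi>' assume "(W, \<theta>) \<in> prod_atlas A B" and V': "(V', \<psi>') \<in> B"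
  then obtain U \<phi> V \<psi> where W: "W = U \<times> V" "\<theta> = map_prod \<phi> \<psi>"
    and U: "(U, \<phi>) \<in> A" and V: "(V, \<psi>) \<in> B"
    by (auto simp: prod_atlas_def)
  note \<phi> = is_chartD[OF manifold_chart[OF A U]] and \<psi> = is_chartD[OF manifold_chart[OF B V]]
  have inj: "inj_on \<theta> W" unfolding W by (rule map_prod_inj_on[OF \<phi>(3) \<psi>(3)])
  note ts = smooth_mapD[OF smooth_map_id[OF B] V V']
  have eq: "\<theta> ` {x\<in>W. snd x \<in> V'} = \<phi> ` U \<times> \<psi> ` {x\<in>V. x \<in> V'}"
    unfolding W by (auto simp: image_iff)
  have "open (\<phi> ` U \<times> \<psi> ` {x\<in>V. x \<in> V'})"
    by (intro open_Times smooth_on_open[OF ts] \<phi>(2))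
  then have "smooth_on r (\<phi> ` U \<times> \<psi> ` {x\<in>V. x \<in> V'}) ((\<psi>' \<circ> (\<lambda>x. x) \<circ> inv_into V \<psi>) \<circ> snd)"
    by (intro smooth_on_compose[OF smooth_on_snd ts]) auto
  then show "smooth_on r (\<theta> ` {x\<in>W. snd x \<in> V'}) (\<psi>' \<circ> snd \<circ> inv_into W \<theta>)"
    unfolding eq[symmetric]
  proof (rule smooth_on_cong)
    fix z assume "z \<in> \<theta> ` {x\<in>W. snd x \<in> V'}"
    then obtain x where x: "x \<in> W" "z = \<theta> x" by blast
    have "inv_into V \<psi> (\<psi> (snd x)) = snd x" using x(1) by (simp add: W \<psi>(3) mem_Times_iff)
    then show "((\<psi>' \<circ> (\<lambda>x. x) \<circ> inv_into V \<psi>) \<circ> snd) z = (\<psi>' \<circ> snd \<circ> inv_into W \<theta>) z"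
      using x by (simp add: inv_into_f_f[OF inj]) (simp add: W)
  qed
qed (simp add: continuous_map_snd)

lemma openin_is_chart_image:
  assumes c: "is_chart X (U, \<phi>)" and W: "openin X W"
  shows "open (\<phi> ` (U \<inter> W))"
proof -
  have "openin (subtopology X U) (U \<inter> W)"
    using W by (auto simp: openin_subtopology)
  then have "openin (top_of_set (\<phi> ` U)) (\<phi> ` (U \<inter> W))"
    using homeomorphic_imp_open_map[OF is_chartD(5)[OF c]] unfolding open_map_def by blast
  then show ?thesis using is_chartD(2)[OF c] by (rule openin_open_trans)
qed

lemma smooth_map_restrict_domain:
  assumes f: "smooth_map r X A Y B f" and A: "manifold r X A" and W: "openin X W"
  shows "smooth_map r (subtopology X W) (restrict_atlas A W) Y B f"
proof (rule smooth_mapI)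
  show "continuous_map (subtopology X W) Y f"
    using smooth_map_continuous[OF f] by (rule continuous_map_from_subtopology)
  fix U' \<phi> V \<psi> assume "(U', \<phi>) \<in> restrict_atlas A W" and V: "(V, \<psi>) \<in> B"
  then obtain U where U: "U' = U \<inter> W" "(U, \<phi>) \<in> A" by (auto simp: restrict_atlas_def)
  note \<phi> = is_chartD[OF manifold_chart[OF A U(2)]]
  note fs = smooth_mapD[OF f U(2) V]
  have inj: "inj_on \<phi> U'" using \<phi>(3) unfolding U by (rule inj_on_subset) auto
  have eq: "\<phi> ` {x\<in>U'. f x \<in> V} = \<phi> ` (U \<inter> W) \<inter> \<phi> ` {x\<in>U. f x \<in> V}"
    using \<phi>(3) unfolding U by (auto simp: inj_on_def)
  have "open (\<phi> ` {x\<in>U'. f x \<in> V})"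
    unfolding eq
    by (intro open_Int smooth_on_open[OF fs] openin_is_chart_image[OF manifold_chart[OF A U(2)] W])
  then have "smooth_on r (\<phi> ` {x\<in>U'. f x \<in> V}) (\<psi> \<circ> f \<circ> inv_into U \<phi>)"
    by (rule smooth_on_subset[OF fs]) (simp add: eq)
  then show "smooth_on r (\<phi> ` {x\<in>U'. f x \<in> V}) (\<psi> \<circ> f \<circ> inv_into U' \<phi>)"
    by (rule smooth_on_cong) (use inj \<phi>(3) U(1) in \<open>auto simp: inv_into_f_f\<close>)
qed

lemma smooth_map_restrict_codomain:
  assumes f: "smooth_map r X A Y B f" and A: "injective_atlas X A" and W: "f ` topspace X \<subseteq> W"
  shows "smooth_map r X A (subtopology Y W) (restrict_atlas B W) f"
proof (rule smooth_mapI)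
  show "continuous_map X (subtopology Y W) f"
    using smooth_map_continuous[OF f] W by (auto simp: continuous_map_in_subtopology)
  fix U \<phi> V' \<psi> assume U: "(U, \<phi>) \<in> A" and "(V', \<psi>) \<in> restrict_atlas B W"
  then obtain V where V: "V' = V \<inter> W" "(V, \<psi>) \<in> B" by (auto simp: restrict_atlas_def)
  have "{x\<in>U. f x \<in> V'} = {x\<in>U. f x \<in> V}"
    using W injective_atlasD(1)[OF A U] unfolding V by auto
  then show "smooth_on r (\<phi> ` {x\<in>U. f x \<in> V'}) (\<psi> \<circ> f \<circ> inv_into U \<phi>)"
    using smooth_mapD[OF f U V(2)] by simp
qed

text \<open>If \<open>\<phi>'\<close> is \<open>\<phi>\<close> carried along \<open>h\<close>, both
  charts have the same image in the model space, and the representative of \<open>f\<close> in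
  \<open>\<phi>'\<close> coincides there with that of \<open>f \<circ> h\<close> in
  \<open>\<phi>\<close>. With \<open>h\<close> the map \<open>\<psi>_g\<close>, charts of
  \<open>G/B\<close> reduce to the chart of \<open>N\<close>.\<close>

lemma smooth_on_chart_transport:
  assumes h: "h ` U = V" and \<phi>: "inj_on \<phi> U" "\<And>x. x \<in> U \<Longrightarrow> \<phi>' (h x) = \<phi> x"
    and f: "smooth_on r (\<phi> ` {x\<in>U. f (h x) \<in> W}) (\<theta> \<circ> (f \<circ> h) \<circ> inv_into U \<phi>)"
  shows "smooth_on r (\<phi>' ` {y\<in>V. f y \<in> W}) (\<theta> \<circ> f \<circ> inv_into V \<phi>')"
proof -
  have inj: "inj_on \<phi>' V" using \<phi> h by (force simp: inj_on_def)
  have "\<phi>' ` {y\<in>V. f y \<in> W} = \<phi> ` {x\<in>U. f (h x) \<in> W}"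
    using \<phi>(2) h by (force simp: image_iff)
  moreover have "smooth_on r (\<phi> ` {x\<in>U. f (h x) \<in> W}) (\<theta> \<circ> f \<circ> inv_into V \<phi>')"
    using f
  proof (rule smooth_on_cong)
    fix z assume "z \<in> \<phi> ` {x\<in>U. f (h x) \<in> W}"
    then obtain x where x: "x \<in> U" "z = \<phi> x" by blast
    then have "h x \<in> V" "z = \<phi>' (h x)" using h \<phi>(2) by auto
    then have "inv_into V \<phi>' z = h x" using inj by simp
    then show "(\<theta> \<circ> (f \<circ> h) \<circ> inv_into U \<phi>) z = (\<theta> \<circ> f \<circ> inv_into V \<phi>') z"
      using x \<phi>(1) by simp
  qed
  ultimately show ?thesis by simp
qed

section \<open>Homogeneous spaces\<close>

lemma openin_prod_topologyE:
  assumes "openin (prod_topology X Y) S" "(x, y) \<in> S"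
  obtains U V where "openin X U" "openin Y V" "x \<in> U" "y \<in> V" "U \<times> V \<subseteq> S"
  using assms openin_prod_topology_alt[of X Y S] by blast

section \<open>The quotient topology of \<open>G/B\<close> for a closed subgroup\<close>

locale closed_lie_subgroup =
  fixes r :: smoothness_class
    and G :: "('g, 'm) monoid_scheme" (structure)
    and X :: "'g topology"
    and A :: "('g, 'e::locally_convex_space) chart set"
    and B :: "'g set"
  assumes lie: "lie_group r G X A" and subgroup: "subgroup B G" and closed: "closedin X B"
begin

sublocale group G using lie by (simp add: lie_group_def)

abbreviation Q where "Q \<equiv> coset_topology G X B"
abbreviation proj where "proj x \<equiv> x <#\<^bsub>G\<^esub> B"
abbreviation param where "param \<equiv> coset_param G B"

lemma topspace_group: "topspace X = carrier G"
  and manifold_group: "manifold r X A"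
  and smooth_mult: "smooth_map r (prod_topology X X) (prod_atlas A A) X A (\<lambda>(x, y). x \<otimes> y)"
  and smooth_inv: "smooth_map r X A X A (\<lambda>x. inv x)"
  using lie by (simp_all add: lie_group_def)

lemma subgroup_carrier: "b \<in> B \<Longrightarrow> b \<in> carrier G"
  by (rule subgroup.mem_carrier[OF subgroup])

lemma injective_atlas_group: "injective_atlas X A"
  by (rule manifold_imp_injective_atlas[OF manifold_group])

lemma smooth_left_translation:
  assumes "g \<in> carrier G"
  shows "smooth_map r X A X A (\<lambda>x. g \<otimes> x)"
proof -
  have "smooth_map r X A (prod_topology X X) (prod_atlas A A) (\<lambda>x. (g, x))"
    using assms by (intro smooth_map_Pair smooth_map_const smooth_map_id manifold_group
        injective_atlas_group) (simp add: topspace_group)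
  from smooth_map_compose[OF this smooth_mult injective_atlas_group
      injective_atlas_prod[OF injective_atlas_group injective_atlas_group]]
  show ?thesis by (simp add: comp_def)
qed

lemma continuous_left_translation: "g \<in> carrier G \<Longrightarrow> continuous_map X X (\<lambda>x. g \<otimes> x)"
  by (rule smooth_map_continuous[OF smooth_left_translation])

lemma continuous_right_translation:
  assumes "g \<in> carrier G"
  shows "continuous_map X X (\<lambda>x. x \<otimes> g)"
proof -
  have "continuous_map X (prod_topology X X) (\<lambda>x. (x, g))"
    using assms by (intro continuous_map_pairedI) (auto simp: topspace_group)
  from continuous_map_compose[OF this smooth_map_continuous[OF smooth_mult]]
  show ?thesis by (simp add: comp_def)
qed

lemma proj_eq_iff:
  assumes "x \<in> carrier G" "y \<in> carrier G"
  shows "proj x = proj y \<longleftrightarrow> inv x \<otimes> y \<in> B"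
proof
  assume "proj x = proj y"
  then have "y \<in> proj x" using lcos_self[OF assms(2) subgroup] by simp
  then show "inv x \<otimes> y \<in> B"
    by (rule subgroup.lcos_module_imp[OF subgroup is_group assms(1)])
next
  assume "inv x \<otimes> y \<in> B"
  then have "y \<in> proj x"
    by (rule subgroup.lcos_module_rev[OF subgroup is_group assms])
  then show "proj x = proj y"
    by (rule l_repr_independence[OF _ assms(1) subgroup])
qed

lemma proj_mult: "g \<in> carrier G \<Longrightarrow> x \<in> carrier G \<Longrightarrow> g <# proj x = proj (g \<otimes> x)"
  by (rule lcos_m_assoc[OF subgroup.subset[OF subgroup]])

lemma topspace_Q: "topspace Q = proj ` carrier G"
  by (simp add: coset_topology_def topspace_quotient_topology topspace_group)

lemma openin_Q:
  "openin Q U \<longleftrightarrow> U \<subseteq> proj ` carrier G \<and> openin X {x \<in> carrier G. proj x \<in> U}"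
  by (simp add: coset_topology_def openin_quotient_topology topspace_group)

lemma continuous_proj: "continuous_map X Q proj"
  using quotient_map_quotient_topology[of X proj]
  by (simp add: coset_topology_def quotient_imp_continuous_map)

text \<open>The saturation of \<open>U\<close> is the union over \<open>b \<in> B\<close> of the
  preimages of \<open>U\<close> under right translation by \<open>b\<close>, each of which is
  open.\<close>

lemma open_proj: "open_map X Q proj"
  unfolding open_map_def
proof (intro allI impI)
  fix U assume U: "openin X U"
  then have UG: "U \<subseteq> carrier G" using openin_subset topspace_group by blast
  have "{x \<in> carrier G. proj x \<in> proj ` U} = (\<Union>b\<in>B. {x \<in> topspace X. x \<otimes> b \<in> U})"
  proof (intro equalityI subsetI)
    fix x assume "x \<in> {x \<in> carrier G. proj x \<in> proj ` U}"
    then obtain u where u: "x \<in> carrier G" "u \<in> U" "proj x = proj u" by blast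
    then have "inv x \<otimes> u \<in> B" using proj_eq_iff UG by blast
    moreover have "x \<otimes> (inv x \<otimes> u) = u"
      using u UG by (metis inv_closed m_assoc r_inv l_one subsetD)
    ultimately show "x \<in> (\<Union>b\<in>B. {x \<in> topspace X. x \<otimes> b \<in> U})"
      using u by (force simp: topspace_group)
  next
    fix x assume "x \<in> (\<Union>b\<in>B. {x \<in> topspace X. x \<otimes> b \<in> U})"
    then obtain b where b: "b \<in> B" "x \<in> carrier G" "x \<otimes> b \<in> U" by (auto simp: topspace_group)
    then have "inv x \<otimes> (x \<otimes> b) = b"
      using subgroup_carrier by (simp add: m_assoc[symmetric])
    then have "proj x = proj (x \<otimes> b)"
      using b by (simp add: proj_eq_iff subsetD[OF UG])
    then show "x \<in> {x \<in> carrier G. proj x \<in> proj ` U}" using b by blast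
  qed
  moreover have "openin X (\<Union>b\<in>B. {x \<in> topspace X. x \<otimes> b \<in> U})"
    by (intro openin_Union ballI)
      (auto intro: openin_continuous_map_preimage[OF continuous_right_translation U] subgroup_carrier)
  ultimately show "openin Q (proj ` U)"
    using UG by (auto simp: openin_Q)
qed

text \<open>As \<open>B\<close> is closed, the pairs with
  \<open>inv x \<otimes> y \<notin> B\<close>, that is, the pairs in distinct cosets, form an open
  set. A box inside it has disjoint projections, and these are open because \<open>proj\<close>
  is.\<close>

lemma Hausdorff_Q: "Hausdorff_space Q"
  unfolding Hausdorff_space_def
proof (intro allI impI)
  fix c d assume "c \<in> topspace Q \<and> d \<in> topspace Q \<and> c \<noteq> d"
  then obtain x y where xy: "x \<in> carrier G" "y \<in> carrier G" "c = proj x" "d = proj y" "proj x \<noteq> proj y"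
    by (auto simp: topspace_Q)
  have "continuous_map (prod_topology X X) (prod_topology X X) (\<lambda>p. (inv (fst p), snd p))"
    using continuous_map_compose[OF continuous_map_fst smooth_map_continuous[OF smooth_inv]]
    by (intro continuous_map_pairedI) (auto simp: comp_def continuous_map_snd)
  from continuous_map_compose[OF this smooth_map_continuous[OF smooth_mult]]
  have "continuous_map (prod_topology X X) X (\<lambda>p. inv (fst p) \<otimes> snd p)"
    by (simp add: comp_def)
  moreover have "openin X (topspace X - B)" using closed by blast
  ultimately have "openin (prod_topology X X)
      {p \<in> topspace (prod_topology X X). inv (fst p) \<otimes> snd p \<in> topspace X - B}"
    by (rule openin_continuous_map_preimage)
  moreover have "(x, y) \<in> {p \<in> topspace (prod_topology X X). inv (fst p) \<otimes> snd p \<in> topspace X - B}"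
    using xy proj_eq_iff by (simp add: topspace_group)
  ultimately obtain U V where UV: "openin X U" "openin X V" "x \<in> U" "y \<in> V"
    "U \<times> V \<subseteq> {p \<in> topspace (prod_topology X X). inv (fst p) \<otimes> snd p \<in> topspace X - B}"
    by (rule openin_prod_topologyE)
  have "proj ` U \<inter> proj ` V = {}"
  proof (rule ccontr)
    assume "proj ` U \<inter> proj ` V \<noteq> {}"
    then obtain u v where uv: "u \<in> U" "v \<in> V" "proj u = proj v" by blast
    then have "(u, v) \<in> {p \<in> topspace (prod_topology X X). inv (fst p) \<otimes> snd p \<in> topspace X - B}"
      using UV(5) by blast
    then have "u \<in> carrier G" "v \<in> carrier G" "inv u \<otimes> v \<notin> B" by (auto simp: topspace_group)
    then show False using uv(3) proj_eq_iff by blast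
  qed
  moreover have "openin Q (proj ` U)" "openin Q (proj ` V)"
    using open_proj UV(1,2) by (auto simp: open_map_def)
  ultimately show "\<exists>U V. openin Q U \<and> openin Q V \<and> c \<in> U \<and> d \<in> V \<and> disjnt U V"
    using UV(3,4) xy(3,4) unfolding disjnt_def by blast
qed

lemma continuous_action: "continuous_map (prod_topology X Q) Q (\<lambda>(g, c). g <# c)"
  unfolding continuous_map_def
proof (intro conjI allI impI)
  show "(\<lambda>(g, c). g <# c) \<in> topspace (prod_topology X Q) \<rightarrow> topspace Q"
    by (auto simp: topspace_group topspace_Q proj_mult)
  fix U assume U: "openin Q U"
  let ?T = "{p \<in> topspace (prod_topology X Q). (case p of (g, c) \<Rightarrow> g <# c) \<in> U}"
  have "continuous_map (prod_topology X X) Q (proj \<circ> (\<lambda>(x, y). x \<otimes> y))"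
    by (rule continuous_map_compose[OF smooth_map_continuous[OF smooth_mult] continuous_proj])
  from openin_continuous_map_preimage[OF this U]
  have S: "openin (prod_topology X X) {p \<in> topspace (prod_topology X X). (proj \<circ> (\<lambda>(x, y). x \<otimes> y)) p \<in> U}"
    (is "openin _ ?S") .
  show "openin (prod_topology X Q) ?T"
    unfolding openin_prod_topology_alt[of X Q]
  proof (intro allI impI)
    fix x c assume "(x, c) \<in> ?T"
    then obtain y where y: "x \<in> carrier G" "y \<in> carrier G" "c = proj y" "x <# c \<in> U"
      by (auto simp: topspace_group topspace_Q)
    then have "(x, y) \<in> ?S" by (simp add: topspace_group proj_mult)
    with S obtain V W where VW: "openin X V" "openin X W" "x \<in> V" "y \<in> W" "V \<times> W \<subseteq> ?S"
      by (rule openin_prod_topologyE)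
    have "V \<times> proj ` W \<subseteq> ?T"
    proof
      fix p assume "p \<in> V \<times> proj ` W"
      then obtain v w where p: "p = (v, proj w)" "v \<in> V" "w \<in> W" by blast
      then have "(v, w) \<in> ?S" using VW(5) by blast
      then show "p \<in> ?T" using p(1) by (auto simp: topspace_group topspace_Q proj_mult)
    qed
    moreover have "openin Q (proj ` W)" using open_proj VW(2) by (auto simp: open_map_def)
    ultimately show "\<exists>U V. openin X U \<and> openin Q V \<and> x \<in> U \<and> c \<in> V \<and> U \<times> V \<subseteq> ?T"
      using VW y(3) by blast
  qed
qed

end

section \<open>The slice \<open>N\<close> and the charts of \<open>G/B\<close> that it
  defines\<close>

locale lie_coset_slice = closed_lie_subgroup r G X A B
  for r and G :: "('g, 'm) monoid_scheme" (structure) and X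
    and A :: "('g, 'e::locally_convex_space) chart set" and B +
  fixes N :: "'g set" and \<eta> :: "'g \<Rightarrow> 'f::locally_convex_space" and \<Omega> \<sigma>
  assumes N_carrier: "N \<subseteq> carrier G" and one_N: "\<one> \<in> N"
    and manifold_N: "manifold r (subtopology X N) {(N, \<eta>)}"
    and smooth_inclusion: "smooth_map r (subtopology X N) {(N, \<eta>)} X A (\<lambda>n. n)"
    and open_\<Omega>: "openin X \<Omega>"
    and homeo: "homeomorphic_map (prod_topology (subtopology X N) (subtopology X B)) (subtopology X \<Omega>)
         (\<lambda>(n, b). n \<otimes> b)"
    and \<sigma>_mult: "\<And>n b. n \<in> N \<Longrightarrow> b \<in> B \<Longrightarrow> \<sigma> (n \<otimes> b) = n"
    and smooth_\<sigma>: "smooth_map r (subtopology X \<Omega>) (restrict_atlas A \<Omega>) (subtopology X N) {(N, \<eta>)} \<sigma>"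
begin

abbreviation \<A> where "\<A> \<equiv> coset_atlas G B N \<eta>"

lemma topspace_N: "topspace (subtopology X N) = N"
  using N_carrier by (auto simp: topspace_subtopology topspace_group)

lemma injective_atlas_N: "injective_atlas (subtopology X N) {(N, \<eta>)}"
  by (rule manifold_imp_injective_atlas[OF manifold_N])

lemma inj_\<eta>: "inj_on \<eta> N"
  using injective_atlasD(2)[OF injective_atlas_N] by blast

lemma \<Omega>_eq: "\<Omega> = (\<lambda>(n, b). n \<otimes> b) ` (N \<times> B)"
proof -
  have "topspace (subtopology X B) = B"
    using closedin_subset[OF closed] by (auto simp: topspace_subtopology)
  moreover have "topspace (subtopology X \<Omega>) = \<Omega>"
    using openin_subset[OF open_\<Omega>] by (auto simp: topspace_subtopology)
  ultimately show ?thesis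
    using homeomorphic_imp_surjective_map[OF homeo] topspace_N by simp
qed

lemma \<Omega>_carrier: "\<Omega> \<subseteq> carrier G"
  using openin_subset[OF open_\<Omega>] by (simp add: topspace_group)

text \<open>Writing \<open>x = n \<otimes> b\<close> shows that \<open>\<sigma>\<close> moves
  \<open>x\<close> within its own coset, to the point of \<open>N\<close>.\<close>

lemma \<sigma>_\<Omega>:
  assumes "x \<in> \<Omega>"
  shows "\<sigma> x \<in> N" "proj (\<sigma> x) = proj x"
proof -
  obtain n b where x: "n \<in> N" "b \<in> B" "x = n \<otimes> b" using assms \<Omega>_eq by auto
  then show "\<sigma> x \<in> N" by (simp add: \<sigma>_mult)
  have n: "n \<in> carrier G" using x(1) N_carrier by blast
  have b: "b \<in> carrier G" using x(2) by (rule subgroup_carrier)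
  have "inv n \<otimes> x = b" using n b by (simp add: x(3) m_assoc[symmetric])
  then show "proj (\<sigma> x) = proj x"
    using x n b by (simp add: \<sigma>_mult proj_eq_iff)
qed

text \<open>A point in the coset of \<open>n\<close> is \<open>n \<otimes> b\<close> with
  \<open>b = inv n \<otimes> x\<close>, so it lies in \<open>NB\<close> and \<open>\<sigma>\<close>
  reads off \<open>n\<close>. Consequently every coset meets \<open>N\<close> in at most one
  point.\<close>

lemma proj_eq_N:
  assumes "x \<in> carrier G" "n \<in> N" "proj n = proj x"
  shows "x \<in> \<Omega>" "\<sigma> x = n"
proof -
  have n: "n \<in> carrier G" using assms(2) N_carrier by blast
  have b: "inv n \<otimes> x \<in> B" using proj_eq_iff[OF n assms(1)] assms(3) by simp
  have x: "x = n \<otimes> (inv n \<otimes> x)" using n assms(1) by (simp add: m_assoc[symmetric])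
  show "x \<in> \<Omega>" unfolding \<Omega>_eq using b assms(2) x by force
  show "\<sigma> x = n" using \<sigma>_mult[OF assms(2) b] x by simp
qed

lemma param_eq: "param g n = proj (g \<otimes> n)"
  by (simp add: coset_param_def)

lemma proj_left_cancel:
  assumes "g \<in> carrier G" "x \<in> carrier G" "y \<in> carrier G"
  shows "proj (g \<otimes> x) = proj y \<longleftrightarrow> proj x = proj (inv g \<otimes> y)"
  using assms by (simp add: proj_eq_iff inv_mult_group m_assoc)

text \<open>The preimage of the chart domain at \<open>g\<close> under the projection is thus the
  translate of \<open>\<Omega>\<close> by \<open>g\<close>.\<close>

lemma proj_in_param_image:
  assumes "g \<in> carrier G" "x \<in> carrier G"
  shows "proj x \<in> param g ` N \<longleftrightarrow> inv g \<otimes> x \<in> \<Omega>"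
proof
  assume "proj x \<in> param g ` N"
  then obtain n where n: "n \<in> N" "proj (g \<otimes> n) = proj x" by (auto simp: param_eq)
  then have "proj n = proj (inv g \<otimes> x)" using proj_left_cancel N_carrier assms by blast
  then show "inv g \<otimes> x \<in> \<Omega>" using proj_eq_N n(1) assms by blast
next
  assume "inv g \<otimes> x \<in> \<Omega>"
  note n = \<sigma>_\<Omega>[OF this]
  then have "proj (g \<otimes> \<sigma> (inv g \<otimes> x)) = proj x"
    using proj_left_cancel N_carrier assms by blast
  then show "proj x \<in> param g ` N" using n(1) by (force simp: param_eq)
qed

lemma param_eq_projD:
  assumes "g \<in> carrier G" "x \<in> carrier G" "n \<in> N" "param g n = proj x"
  shows "inv g \<otimes> x \<in> \<Omega>" "\<sigma> (inv g \<otimes> x) = n"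
proof -
  have "proj n = proj (inv g \<otimes> x)"
    using assms proj_left_cancel N_carrier unfolding param_eq by blast
  then show "inv g \<otimes> x \<in> \<Omega>" "\<sigma> (inv g \<otimes> x) = n"
    using proj_eq_N assms by auto
qed

lemma inj_param:
  assumes g: "g \<in> carrier G"
  shows "inj_on (param g) N"
proof (rule inj_onI)
  fix n m assume nm: "n \<in> N" "m \<in> N" "param g n = param g m"
  have gm: "g \<otimes> m \<in> carrier G" using nm(2) N_carrier g by auto
  have "\<sigma> (inv g \<otimes> (g \<otimes> m)) = n"
    by (rule param_eq_projD(2)[OF g gm nm(1)]) (use nm(3) in \<open>simp only: param_eq\<close>)
  moreover have "\<sigma> (inv g \<otimes> (g \<otimes> m)) = m"
    by (rule param_eq_projD(2)[OF g gm nm(2)]) (simp only: param_eq)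
  ultimately show "n = m" by simp
qed

lemma inv_into_param:
  assumes g: "g \<in> carrier G" and x: "x \<in> carrier G" and "inv g \<otimes> x \<in> \<Omega>"
  shows "inv_into N (param g) (proj x) = \<sigma> (inv g \<otimes> x)"
proof -
  have "proj x \<in> param g ` N" using assms by (simp add: proj_in_param_image)
  then obtain n where n: "n \<in> N" "param g n = proj x" by auto
  then show ?thesis
    using param_eq_projD(2)[OF g x n] inv_into_f_f[OF inj_param[OF g] n(1)] by simp
qed

lemma param_image_subset: "g \<in> carrier G \<Longrightarrow> param g ` N \<subseteq> proj ` carrier G"
  using N_carrier by (auto simp: param_eq)

lemma openin_translate_\<Omega>:
  assumes "g \<in> carrier G"
  shows "openin X {x \<in> carrier G. inv g \<otimes> x \<in> \<Omega>}"
  using openin_continuous_map_preimage[OF continuous_left_translation open_\<Omega>, of "inv g"] assms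
  by (simp add: topspace_group)

lemma open_param_image:
  assumes g: "g \<in> carrier G" and V: "openin (subtopology X N) V"
  shows "openin Q (param g ` V)"
proof -
  have VN: "V \<subseteq> N" using openin_subset[OF V] topspace_N by simp
  have "{x \<in> carrier G. proj x \<in> param g ` V} =
      {x \<in> topspace X. inv g \<otimes> x \<in> {y \<in> \<Omega>. \<sigma> y \<in> V}}"
  proof (intro equalityI subsetI)
    fix x assume "x \<in> {x \<in> carrier G. proj x \<in> param g ` V}"
    then obtain n where "x \<in> carrier G" "n \<in> V" "param g n = proj x" by auto
    then show "x \<in> {x \<in> topspace X. inv g \<otimes> x \<in> {y \<in> \<Omega>. \<sigma> y \<in> V}}"
      using param_eq_projD[OF g] VN by (auto simp: topspace_group)
  next
    fix x assume x: "x \<in> {x \<in> topspace X. inv g \<otimes> x \<in> {y \<in> \<Omega>. \<sigma> y \<in> V}}"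
    then have "param g (\<sigma> (inv g \<otimes> x)) = proj x"
      using inv_into_param[OF g, of x] proj_in_param_image[OF g, of x]
        f_inv_into_f[of "proj x" "param g" N] by (auto simp: topspace_group)
    then show "x \<in> {x \<in> carrier G. proj x \<in> param g ` V}"
      using x by (force simp: topspace_group)
  qed
  moreover have "openin X {y \<in> \<Omega>. \<sigma> y \<in> V}"
  proof -
    have "openin (subtopology X \<Omega>) {y \<in> topspace (subtopology X \<Omega>). \<sigma> y \<in> V}"
      by (rule openin_continuous_map_preimage[OF smooth_map_continuous[OF smooth_\<sigma>] V])
    moreover have "topspace (subtopology X \<Omega>) = \<Omega>"
      using \<Omega>_carrier by (auto simp: topspace_subtopology topspace_group)
    ultimately show ?thesis using openin_trans_full[OF _ open_\<Omega>] by metis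
  qed
  then have "openin X {x \<in> topspace X. inv g \<otimes> x \<in> {y \<in> \<Omega>. \<sigma> y \<in> V}}"
    by (rule openin_continuous_map_preimage[OF continuous_left_translation[OF inv_closed[OF g]]])
  moreover have "param g ` V \<subseteq> proj ` carrier G"
    using image_mono[OF VN] param_image_subset[OF g] by (rule order_trans)
  ultimately show ?thesis by (simp only: openin_Q)
qed

lemma smooth_translate_inclusion:
  assumes "g \<in> carrier G"
  shows "smooth_map r (subtopology X N) {(N, \<eta>)} X A (\<lambda>n. g \<otimes> n)"
  using smooth_map_compose[OF smooth_inclusion smooth_left_translation[OF assms]
      injective_atlas_N injective_atlas_group]
  by (simp add: comp_def)

lemma homeomorphic_maps_param:
  assumes g: "g \<in> carrier G"
  shows "homeomorphic_maps (subtopology X N) (subtopology Q (param g ` N)) (param g) (inv_into N (param g))"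
proof -
  let ?Y = "subtopology Q (param g ` N)"
  have "continuous_map (subtopology X N) Q (param g)"
    using continuous_map_compose[OF smooth_map_continuous[OF smooth_translate_inclusion[OF g]] continuous_proj]
    by (simp add: comp_def param_eq[abs_def])
  then have cont: "continuous_map (subtopology X N) ?Y (param g)"
    using topspace_N by (auto simp: continuous_map_in_subtopology)
  have top: "topspace ?Y = param g ` N"
    using param_image_subset[OF g] by (auto simp: topspace_subtopology topspace_Q)
  have "open_map (subtopology X N) ?Y (param g)"
    unfolding open_map_def
  proof (intro allI impI)
    fix V assume V: "openin (subtopology X N) V"
    then have "V \<subseteq> N" using openin_subset topspace_N by metis
    then have "param g ` V = param g ` V \<inter> param g ` N" by blast
    then show "openin ?Y (param g ` V)"
      using open_param_image[OF g V] unfolding openin_subtopology by metis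
  qed
  then have "homeomorphic_map (subtopology X N) ?Y (param g)"
    using cont inj_param[OF g] by (intro bijective_open_imp_homeomorphic_map) (simp_all only: top topspace_N)
  then obtain k where k: "homeomorphic_maps (subtopology X N) ?Y (param g) k"
    unfolding homeomorphic_map_maps ..
  \<comment> \<open>The homeomorphism theorem yields some inverse \<open>k\<close>; injectivity
    identifies it on the image with the explicit one that appears in the charts.\<close>
  have "k y = inv_into N (param g) y" if y: "y \<in> topspace ?Y" for y
  proof -
    obtain n where "n \<in> N" "y = param g n" using y top by auto
    then show ?thesis using k inv_into_f_f[OF inj_param[OF g]] topspace_N
      by (simp add: homeomorphic_maps_def)
  qed
  then show ?thesis using k by (intro homeomorphic_maps_eq[OF k]) auto
qed

lemma chart_inverse_param:
  assumes g: "g \<in> carrier G" and n: "n \<in> N"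
  shows "(\<eta> \<circ> inv_into N (param g)) (param g n) = \<eta> n"
  using n inv_into_f_f[OF inj_param[OF g]] by simp

lemma is_chart_param:
  assumes g: "g \<in> carrier G"
  shows "is_chart Q (param g ` N, \<eta> \<circ> inv_into N (param g))"
proof -
  have \<eta>: "is_chart (subtopology X N) (N, \<eta>)"
    using manifold_chart[OF manifold_N] by simp
  have image: "(\<eta> \<circ> inv_into N (param g)) ` (param g ` N) = \<eta> ` N"
    using chart_inverse_param[OF g] by (force simp: image_iff)
  have "homeomorphic_map (subtopology Q (param g ` N)) (subtopology X N) (inv_into N (param g))"
    using homeomorphic_maps_param[OF g] by (simp add: homeomorphic_maps_map)
  moreover have "homeomorphic_map (subtopology X N) (top_of_set (\<eta> ` N)) \<eta>"
    using is_chartD(5)[OF \<eta>] by (simp add: subtopology_subtopology)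
  ultimately have "homeomorphic_map (subtopology Q (param g ` N)) (top_of_set (\<eta> ` N))
      (\<eta> \<circ> inv_into N (param g))"
    by (rule homeomorphic_map_compose)
  moreover have "openin Q (param g ` N)"
    using open_param_image[OF g openin_topspace] topspace_N by simp
  ultimately show ?thesis
    using is_chartD(2)[OF \<eta>] unfolding is_chart_def prod.case image by blast
qed

lemma coset_atlasE:
  assumes "c \<in> \<A>"
  obtains g where "g \<in> carrier G" "c = (param g ` N, \<eta> \<circ> inv_into N (param g))"
  using assms by (auto simp: coset_atlas_def)

lemma param_in_coset_atlas: "g \<in> carrier G \<Longrightarrow> (param g ` N, \<eta> \<circ> inv_into N (param g)) \<in> \<A>"
  by (auto simp: coset_atlas_def)

lemma coset_atlas_cover: "(\<Union>c\<in>\<A>. fst c) = topspace Q"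
proof
  show "(\<Union>c\<in>\<A>. fst c) \<subseteq> topspace Q"
    using param_image_subset by (auto simp: coset_atlas_def topspace_Q)
  show "topspace Q \<subseteq> (\<Union>c\<in>\<A>. fst c)"
  proof
    fix c assume "c \<in> topspace Q"
    then obtain x where x: "x \<in> carrier G" "c = proj x" by (auto simp: topspace_Q)
    then have "c = param x \<one>" by (simp add: param_eq)
    then show "c \<in> (\<Union>c\<in>\<A>. fst c)" using one_N x(1) by (auto simp: coset_atlas_def)
  qed
qed

lemma smooth_proj: "smooth_map r X A Q \<A> proj"
proof (rule smooth_mapI[OF continuous_proj])
  fix U \<phi> V \<psi> assume U: "(U, \<phi>) \<in> A" and "(V, \<psi>) \<in> \<A>"
  then obtain g where g: "g \<in> carrier G" and V: "V = param g ` N" "\<psi> = \<eta> \<circ> inv_into N (param g)"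
    by (elim coset_atlasE) simp
  note \<phi> = injective_atlasD[OF injective_atlas_group U]
  define W where "W = {x \<in> carrier G. inv g \<otimes> x \<in> \<Omega>}"
  have W: "openin X W" unfolding W_def by (rule openin_translate_\<Omega>[OF g])
  \<comment> \<open>\<open>\<sigma>\<close> is smooth as a map on \<open>\<Omega>\<close> with the
    restricted atlas, so the translation has to be cut down to a map from \<open>W\<close>, the
    translate of \<open>\<Omega>\<close> by \<open>g\<close>, to \<open>\<Omega>\<close> before the
    two can be composed.\<close>
  have "smooth_map r (subtopology X W) (restrict_atlas A W) (subtopology X \<Omega>) (restrict_atlas A \<Omega>)
      (\<lambda>x. inv g \<otimes> x)"
    using g
    by (intro smooth_map_restrict_codomain smooth_map_restrict_domain smooth_left_translation W
        manifold_group injective_atlas_restrict injective_atlas_group)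
      (auto simp: W_def topspace_subtopology)
  from smooth_map_compose[OF this smooth_\<sigma>]
  have s: "smooth_map r (subtopology X W) (restrict_atlas A W) (subtopology X N) {(N, \<eta>)}
      (\<sigma> \<circ> (\<lambda>x. inv g \<otimes> x))"
    by (simp add: injective_atlas_restrict[OF injective_atlas_group])
  have "(U \<inter> W, \<phi>) \<in> restrict_atlas A W" using U by (force simp: restrict_atlas_def)
  from smooth_mapD[OF s this, of N \<eta>]
  have "smooth_on r (\<phi> ` {x \<in> U \<inter> W. \<sigma> (inv g \<otimes> x) \<in> N})
      (\<eta> \<circ> (\<sigma> \<circ> (\<lambda>x. inv g \<otimes> x)) \<circ> inv_into (U \<inter> W) \<phi>)"
    by simp
  moreover have "x \<in> W \<and> \<sigma> (inv g \<otimes> x) \<in> N \<longleftrightarrow> proj x \<in> V" if "x \<in> U" for x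
  proof -
    have "x \<in> carrier G" using that \<phi>(1) topspace_group by auto
    then show ?thesis
      using \<sigma>_\<Omega>(1) unfolding V proj_in_param_image[OF g \<open>x \<in> carrier G\<close>] by (auto simp: W_def)
  qed
  then have "{x \<in> U \<inter> W. \<sigma> (inv g \<otimes> x) \<in> N} = {x \<in> U. proj x \<in> V}" by blast
  ultimately have "smooth_on r (\<phi> ` {x \<in> U. proj x \<in> V})
      (\<eta> \<circ> (\<sigma> \<circ> (\<lambda>x. inv g \<otimes> x)) \<circ> inv_into (U \<inter> W) \<phi>)"
    by simp
  then show "smooth_on r (\<phi> ` {x \<in> U. proj x \<in> V}) (\<psi> \<circ> proj \<circ> inv_into U \<phi>)"
  proof (rule smooth_on_cong)
    fix z assume "z \<in> \<phi> ` {x \<in> U. proj x \<in> V}"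
    then obtain x where x: "x \<in> U" "proj x \<in> V" "z = \<phi> x" by blast
    then have xG: "x \<in> carrier G" using \<phi>(1) topspace_group by auto
    with x(2) have x\<Omega>: "inv g \<otimes> x \<in> \<Omega>" by (simp add: V proj_in_param_image[OF g])
    then have xW: "x \<in> U \<inter> W" using x(1) xG by (simp add: W_def)
    have "inj_on \<phi> (U \<inter> W)" using \<phi>(2) by (rule inj_on_subset) simp
    then have "inv_into (U \<inter> W) \<phi> z = x" using xW x(3) by simp
    moreover have "inv_into U \<phi> z = x" using \<phi>(2) x by simp
    ultimately show "(\<eta> \<circ> (\<sigma> \<circ> (\<lambda>x. inv g \<otimes> x)) \<circ> inv_into (U \<inter> W) \<phi>) z = (\<psi> \<circ> proj \<circ> inv_into U \<phi>) z"
      using inv_into_param[OF g xG x\<Omega>] by (simp add: V)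
  qed
qed

lemma smooth_param:
  assumes "smooth_map r X A Q \<B> proj" "g \<in> carrier G"
  shows "smooth_map r (subtopology X N) {(N, \<eta>)} Q \<B> (param g)"
  using smooth_map_compose[OF smooth_translate_inclusion[OF assms(2)] assms(1)
      injective_atlas_N injective_atlas_group]
  by (simp add: comp_def param_eq[abs_def])

text \<open>The chart at \<open>g\<close> is \<open>\<eta>\<close> transported along
  \<open>param g\<close>, so the representative of \<open>f\<close> in it is that of
  \<open>f \<circ> param g\<close> in \<open>\<eta>\<close>.\<close>

lemma smooth_map_coset_atlas:
  assumes "continuous_map Q Z f"
    and "\<And>g. g \<in> carrier G \<Longrightarrow> smooth_map r (subtopology X N) {(N, \<eta>)} Z \<C> (f \<circ> param g)"
  shows "smooth_map r Q \<A> Z \<C> f"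
proof (rule smooth_mapI[OF assms(1)])
  fix V \<psi> W \<theta> assume "(V, \<psi>) \<in> \<A>" and W: "(W, \<theta>) \<in> \<C>"
  then obtain g where g: "g \<in> carrier G" and V: "V = param g ` N" "\<psi> = \<eta> \<circ> inv_into N (param g)"
    by (elim coset_atlasE) simp
  show "smooth_on r (\<psi> ` {x \<in> V. f x \<in> W}) (\<theta> \<circ> f \<circ> inv_into V \<psi>)"
  proof (rule smooth_on_chart_transport[of "param g" N V \<eta>])
    show "smooth_on r (\<eta> ` {x \<in> N. f (param g x) \<in> W}) (\<theta> \<circ> (f \<circ> param g) \<circ> inv_into N \<eta>)"
      using smooth_mapD[OF assms(2)[OF g] _ W, of N \<eta>] by simp
  qed (use chart_inverse_param[OF g] in \<open>simp_all add: V inj_\<eta>\<close>)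
qed

text \<open>For \<open>\<B> = \<A>\<close> this is the compatibility of the charts; for the atlas of
  another slice it is one half of the comparison.\<close>

lemma smooth_id_of_smooth_proj:
  assumes "smooth_map r X A Q \<B> proj"
  shows "smooth_map r Q \<A> Q \<B> (\<lambda>c. c)"
  using smooth_param[OF assms]
  by (intro smooth_map_coset_atlas) (simp_all add: comp_def)

lemma manifold_Q: "manifold r Q \<A>"
  unfolding manifold_def
proof (intro conjI ballI Hausdorff_Q coset_atlas_cover)
  fix c assume c: "c \<in> \<A>"
  then show "is_chart Q c" using is_chart_param by (auto elim: coset_atlasE)
  fix d assume d: "d \<in> \<A>"
  obtain U \<phi> V \<psi> where cd: "c = (U, \<phi>)" "d = (V, \<psi>)" by fastforce
  have "smooth_on r (\<phi> ` {x \<in> U. x \<in> V}) (\<psi> \<circ> (\<lambda>x. x) \<circ> inv_into U \<phi>)"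
    using c d unfolding cd by (rule smooth_mapD[OF smooth_id_of_smooth_proj[OF smooth_proj]])
  then show "smooth_transition r c d"
    by (simp add: cd smooth_transition_def Int_def comp_def)
qed

lemma diffeomorphism_param:
  assumes g: "g \<in> carrier G"
  shows "diffeomorphism r (subtopology X N) {(N, \<eta>)}
    (subtopology Q (param g ` N)) (restrict_atlas \<A> (param g ` N)) (param g)"
  unfolding diffeomorphism_def
proof (intro exI conjI)
  let ?W = "param g ` N" and ?\<psi> = "\<eta> \<circ> inv_into N (param g)"
  show "homeomorphic_maps (subtopology X N) (subtopology Q ?W) (param g) (inv_into N (param g))"
    by (rule homeomorphic_maps_param[OF g])
  show "smooth_map r (subtopology X N) {(N, \<eta>)} (subtopology Q ?W) (restrict_atlas \<A> ?W) (param g)"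
    using topspace_N
    by (intro smooth_map_restrict_codomain smooth_param smooth_proj g injective_atlas_N) simp
  have W: "openin Q ?W" using is_chartD(1)[OF is_chart_param[OF g]] .
  \<comment> \<open>In the chart \<open>\<eta>\<close> the inverse of \<open>param g\<close> is
    itself the chart of \<open>\<A>\<close> at \<open>g\<close>, so its representatives are those of
    the identity of \<open>G/B\<close>.\<close>
  have id: "smooth_map r (subtopology Q ?W) (restrict_atlas \<A> ?W) Q \<A> (\<lambda>c. c)"
    by (intro smooth_map_restrict_domain smooth_map_id manifold_Q W)
  show "smooth_map r (subtopology Q ?W) (restrict_atlas \<A> ?W) (subtopology X N) {(N, \<eta>)} (inv_into N (param g))"
  proof (rule smooth_mapI)
    show "continuous_map (subtopology Q ?W) (subtopology X N) (inv_into N (param g))"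
      using homeomorphic_maps_param[OF g] by (simp add: homeomorphic_maps_def)
    fix U \<phi> V \<psi> assume U: "(U, \<phi>) \<in> restrict_atlas \<A> ?W" and "(V, \<psi>) \<in> {(N, \<eta>)}"
    then have V: "V = N" "\<psi> = \<eta>" by auto
    have "U \<subseteq> ?W" using U by (auto simp: restrict_atlas_def)
    then have "{x \<in> U. inv_into N (param g) x \<in> V} = {x \<in> U. x \<in> ?W}"
      unfolding V by (auto intro: inv_into_into)
    then show "smooth_on r (\<phi> ` {x \<in> U. inv_into N (param g) x \<in> V}) (\<psi> \<circ> inv_into N (param g) \<circ> inv_into U \<phi>)"
      using smooth_mapD[OF id U param_in_coset_atlas[OF g]] by (simp add: V comp_def)
  qed
qed

text \<open>Composed with the identity of \<open>G\<close> times \<open>param g\<close>, the action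
  becomes \<open>(x, n) \<mapsto> proj (x \<otimes> (g \<otimes> n))\<close>, which is built from
  multiplication and projection. The product chart of \<open>G \<times> G/B\<close> is
  \<open>map_prod \<phi> \<eta>\<close> transported along that map.\<close>

lemma smooth_action: "smooth_map r (prod_topology X Q) (prod_atlas A \<A>) Q \<A> (\<lambda>(g, c). g <# c)"
proof (rule smooth_mapI[OF continuous_action])
  fix T \<theta> W \<zeta>' assume "(T, \<theta>) \<in> prod_atlas A \<A>" and W: "(W, \<zeta>') \<in> \<A>"
  then obtain U \<phi> V \<psi> where T: "T = U \<times> V" "\<theta> = map_prod \<phi> \<psi>" and U: "(U, \<phi>) \<in> A" and "(V, \<psi>) \<in> \<A>"
    by (auto simp: prod_atlas_def)
  then obtain g where g: "g \<in> carrier G" and V: "V = param g ` N" "\<psi> = \<eta> \<circ> inv_into N (param g)"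
    by (elim coset_atlasE) simp
  note \<phi> = injective_atlasD[OF injective_atlas_group U]
  let ?P = "prod_topology X (subtopology X N)" and ?C = "prod_atlas A {(N, \<eta>)}"
  note P = injective_atlas_prod[OF injective_atlas_group injective_atlas_N]
  have "smooth_map r ?P ?C X A ((\<lambda>n. g \<otimes> n) \<circ> snd)"
    by (intro smooth_map_compose[OF smooth_map_snd] manifold_group manifold_N P injective_atlas_N
        smooth_translate_inclusion g)
  then have "smooth_map r ?P ?C (prod_topology X X) (prod_atlas A A) (\<lambda>p. (fst p, ((\<lambda>n. g \<otimes> n) \<circ> snd) p))"
    by (intro smooth_map_Pair smooth_map_fst manifold_group manifold_N P)
  from smooth_map_compose[OF this smooth_mult P injective_atlas_prod[OF injective_atlas_group injective_atlas_group]]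
  have "smooth_map r ?P ?C X A (\<lambda>p. fst p \<otimes> (g \<otimes> snd p))" by (simp add: comp_def)
  from smooth_map_compose[OF this smooth_proj P injective_atlas_group]
  have "smooth_map r ?P ?C Q \<A> (\<lambda>p. proj (fst p \<otimes> (g \<otimes> snd p)))" by (simp add: comp_def)
  then have s: "smooth_map r ?P ?C Q \<A> ((\<lambda>(g, c). g <# c) \<circ> map_prod (\<lambda>x. x) (param g))"
    by (rule smooth_map_cong[OF _ P])
      (use g N_carrier in \<open>auto simp: param_eq proj_mult topspace_group\<close>)
  have UN: "(U \<times> N, map_prod \<phi> \<eta>) \<in> ?C" using U by (force simp: prod_atlas_def)
  show "smooth_on r (\<theta> ` {x \<in> T. (case x of (g, c) \<Rightarrow> g <# c) \<in> W}) (\<zeta>' \<circ> (\<lambda>(g, c). g <# c) \<circ> inv_into T \<theta>)"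
  proof (rule smooth_on_chart_transport[of "map_prod (\<lambda>x. x) (param g)" "U \<times> N" T "map_prod \<phi> \<eta>"])
    show "map_prod (\<lambda>x. x) (param g) ` (U \<times> N) = T" by (force simp: T V)
    show "inj_on (map_prod \<phi> \<eta>) (U \<times> N)" using map_prod_inj_on[OF \<phi>(2) inj_\<eta>] .
    fix x assume "x \<in> U \<times> N"
    then show "\<theta> (map_prod (\<lambda>x. x) (param g) x) = map_prod \<phi> \<eta> x"
      using chart_inverse_param[OF g] by (auto simp: T V)
  next
    show "smooth_on r (map_prod \<phi> \<eta> ` {x \<in> U \<times> N. (case map_prod (\<lambda>x. x) (param g) x of (g, c) \<Rightarrow> g <# c) \<in> W})
        (\<zeta>' \<circ> ((\<lambda>(g, c). g <# c) \<circ> map_prod (\<lambda>x. x) (param g)) \<circ> inv_into (U \<times> N) (map_prod \<phi> \<eta>))"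
      using smooth_mapD[OF s UN W] by simp
  qed
qed

end

lemma coset_sliceE:
  assumes "lie_group r G X A" "subgroup B G" "closedin X B" "coset_slice r G X A B N \<eta>"
  obtains \<Omega> \<sigma> where "lie_coset_slice r G X A B N \<eta> \<Omega> \<sigma>"
proof -
  from assms(4) obtain \<Omega> \<sigma> where "openin X \<Omega>"
    "homeomorphic_map (prod_topology (subtopology X N) (subtopology X B)) (subtopology X \<Omega>)
       (\<lambda>(n, b). n \<otimes>\<^bsub>G\<^esub> b)"
    "\<And>n b. n \<in> N \<Longrightarrow> b \<in> B \<Longrightarrow> \<sigma> (n \<otimes>\<^bsub>G\<^esub> b) = n"
    "smooth_map r (subtopology X \<Omega>) (restrict_atlas A \<Omega>) (subtopology X N) {(N, \<eta>)} \<sigma>"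
    unfolding coset_slice_def by blast
  then have "lie_coset_slice r G X A B N \<eta> \<Omega> \<sigma>"
    using assms
    unfolding lie_coset_slice_def closed_lie_subgroup_def lie_coset_slice_axioms_def coset_slice_def
    by simp
  then show ?thesis by (rule that)
qed

theorem lemmaA1:
  fixes r :: smoothness_class
    and G :: "('g, 'm) monoid_scheme"
    and X :: "'g topology"
    and A :: "('g, 'e::locally_convex_space) chart set"
    and B N N' :: "'g set"
    and \<eta> :: "'g \<Rightarrow> 'f::locally_convex_space"
    and \<eta>' :: "'g \<Rightarrow> 'h::locally_convex_space"
  assumes "lie_group r G X A"
    and "subgroup B G" and "closedin X B"
    and "coset_slice r G X A B N \<eta>"
  shows "(let Q = coset_topology G X B; \<A> = coset_atlas G B N \<eta> in
      manifold r Q \<A> \<and>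
      (\<forall>g\<in>carrier G. inj_on (coset_param G B g) N \<and> openin Q (coset_param G B g ` N) \<and>
         diffeomorphism r (subtopology X N) {(N, \<eta>)}
           (subtopology Q (coset_param G B g ` N)) (restrict_atlas \<A> (coset_param G B g ` N))
           (coset_param G B g)) \<and>
      smooth_map r X A Q \<A> (\<lambda>x. x <#\<^bsub>G\<^esub> B) \<and>
      open_map X Q (\<lambda>x. x <#\<^bsub>G\<^esub> B) \<and>
      smooth_map r (prod_topology X Q) (prod_atlas A \<A>) Q \<A> (\<lambda>(g, c). g <#\<^bsub>G\<^esub> c) \<and>
      (coset_slice r G X A B N' \<eta>' \<longrightarrow>
         same_smooth_structure r Q \<A> (coset_atlas G B N' \<eta>')))"
proof -
  obtain \<Omega> \<sigma> where "lie_coset_slice r G X A B N \<eta> \<Omega> \<sigma>"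
    using coset_sliceE[OF assms] .
  then interpret S: lie_coset_slice r G X A B N \<eta> \<Omega> \<sigma> .
  have "same_smooth_structure r S.Q S.\<A> (coset_atlas G B N' \<eta>')"
    if slice': "coset_slice r G X A B N' \<eta>'"
  proof -
    obtain \<Omega>' \<sigma>' where "lie_coset_slice r G X A B N' \<eta>' \<Omega>' \<sigma>'"
      using coset_sliceE[OF assms(1-3) slice'] .
    then interpret S': lie_coset_slice r G X A B N' \<eta>' \<Omega>' \<sigma>' .
    show ?thesis
      unfolding same_smooth_structure_def diffeomorphism_def
      \<comment> \<open>Both slices live on the same quotient space with the same projection, which
        is smooth for either atlas; hence the identity is smooth in both directions.\<close>
      using S.smooth_id_of_smooth_proj[OF S'.smooth_proj] S'.smooth_id_of_smooth_proj[OF S.smooth_proj]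
      by (intro exI[of _ "\<lambda>c. c"]) (simp add: homeomorphic_maps_def)
  qed
  then show ?thesis
    unfolding Let_def
    using S.manifold_Q S.inj_param S.diffeomorphism_param S.smooth_proj S.open_proj S.smooth_action
      is_chartD(1)[OF S.is_chart_param]
    by blast
qed

end
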